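(* Let $\Gamma$ be a bipartite distance-regular graph with vertex set $X$, valency $k\ge3$ and diameter $D\ge4$. Assume that for every $x\in X$, up to isomorphism there exist exactly two irreducible $T(x)$-modules with endpoint $2$, and these modules are thin. Let $2\le i\le D-2$. Then $\Delta_i>0$, and whenever $\alpha_i,\beta_i$ are complex scalars such that for all $x,y,z\in X$ with $\partial(x,y)=2$, $\partial(x,z)=i$, $\partial(y,z)=i$, $$\alpha_i + \beta_i\,|\Gamma(x)\cap\Gamma(y)\cap\Gamma_{i-1}(z)| = |\Gamma_{i-1}(x)\cap\Gamma_{i-1}(y)\cap\Gamma(z)|,$$ we have $$\alpha_i=\frac{c_i(c_i-1)(b_{i-1}-c_2)-c_ic_{i-1}(b_i-1)(c_2-1)}{c_2\Delta_i},\qquad \beta_i=\frac{c_i(c_{i+1}-c_i)(b_{i-1}-1)-b_i(c_{i+1}-1)(c_i-c_{i-1})}{c_2\Delta_i}.$$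
   Context: $\Gamma$ is finite, connected, undirected, without loops or multiple edges; $\partial$ is the path-length distance, $\Gamma_i(z)$ is the set of vertices at distance $i$ from $z$, $\Gamma(z)=\Gamma_1(z)$. Intersection numbers: $p^h_{ij}=|\Gamma_i(u)\cap\Gamma_j(w)|$ for $\partial(u,w)=h$; $c_i=p^i_{1,i-1}$, $b_i=p^i_{1,i+1}$, $c_0=b_D=0$, $k=b_0$; since $\Gamma$ is bipartite, $b_i+c_i=k$. For $2\le i\le D-1$, $\Delta_i=(b_{i-1}-1)(c_{i+1}-1)-(c_2-1)p^i_{2i}$. For $x\in X$, $E_i^*=E_i^*(x)$ is the diagonal $0/1$ matrix in $\mathrm{Mat}_X(\mathbb{C})$ projecting onto the coordinates of vertices at distance $i$ from $x$; $T(x)$ is the subalgebra of $\mathrm{Mat}_X(\mathbb{C})$ generated by the adjacency matrix $A$ and $E_0^*,\dots,E_D^*$. $T(x)$-modules are subspaces of $V=\mathbb{C}^X$ invariant under $T(x)$; irreducible, isomorphic as usual; the endpoint of an irreducible module $W$ is $\min\{i:E_i^*W\ne0\}$; $W$ is thin if $\dim E_i^*W\le1$ for all $i$. *)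

theory Defs
  imports "HOL-Analysis.Analysis"
begin

section \<open>Distance-regular graphs\<close>

text \<open>A graph is given by its adjacency relation; the vertex set \<open>X\<close> is a whole (finite) type.\<close>

definition simple_graph :: "('a \<Rightarrow> 'a \<Rightarrow> bool) \<Rightarrow> bool" where
  "simple_graph adj \<longleftrightarrow> (\<forall>x y. adj x y \<longrightarrow> adj y x) \<and> (\<forall>x. \<not> adj x x)"

definition connected_graph :: "('a \<Rightarrow> 'a \<Rightarrow> bool) \<Rightarrow> bool" where
  "connected_graph adj \<longleftrightarrow> (\<forall>x y. adj\<^sup>*\<^sup>* x y)"

definition bipartite_graph :: "('a \<Rightarrow> 'a \<Rightarrow> bool) \<Rightarrow> bool" where
  "bipartite_graph adj \<longleftrightarrow> (\<exists>S. \<forall>x y. adj x y \<longrightarrow> (x \<in> S \<longleftrightarrow> y \<notin> S))"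

text \<open>\<open>adj ^^ n\<close> relates the end points of the walks of length \<open>n\<close>; a shortest walk is a path.
  The value is meaningful only for connected graphs.\<close>

definition gdist :: "('a \<Rightarrow> 'a \<Rightarrow> bool) \<Rightarrow> 'a \<Rightarrow> 'a \<Rightarrow> nat" where
  "gdist adj x y = (LEAST n. (adj ^^ n) x y)"

definition sphere_at :: "('a \<Rightarrow> 'a \<Rightarrow> bool) \<Rightarrow> nat \<Rightarrow> 'a \<Rightarrow> 'a set" where
  "sphere_at adj i z = {y. gdist adj z y = i}"

definition diam :: "('a::finite \<Rightarrow> 'a \<Rightarrow> bool) \<Rightarrow> nat" where
  "diam adj = Max {gdist adj x y | x y. True}"

definition distance_regular :: "('a::finite \<Rightarrow> 'a \<Rightarrow> bool) \<Rightarrow> bool" where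
  "distance_regular adj \<longleftrightarrow> simple_graph adj \<and> connected_graph adj \<and>
     (\<forall>h\<le>diam adj. \<forall>i\<le>diam adj. \<forall>j\<le>diam adj. \<exists>n. \<forall>u w. gdist adj u w = h \<longrightarrow>
        card (sphere_at adj i u \<inter> sphere_at adj j w) = n)"

text \<open>The intersection number \<open>p\<^sup>h\<^sub>i\<^sub>j\<close>, well defined in a distance-regular graph
  whenever \<open>h\<close> is at most the diameter.\<close>

definition inter_num :: "('a::finite \<Rightarrow> 'a \<Rightarrow> bool) \<Rightarrow> nat \<Rightarrow> nat \<Rightarrow> nat \<Rightarrow> nat" where
  "inter_num adj h i j =
     (THE n. \<forall>u w. gdist adj u w = h \<longrightarrow> card (sphere_at adj i u \<inter> sphere_at adj j w) = n)"

text \<open>The numbers \<open>c\<^sub>i\<close>, \<open>b\<^sub>i\<close> and \<open>\<Delta>\<^sub>i\<close> are integers, so that the subtractions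
  in the formulas are not truncated.\<close>

definition inter_c :: "('a::finite \<Rightarrow> 'a \<Rightarrow> bool) \<Rightarrow> nat \<Rightarrow> int" where
  "inter_c adj i = (if i = 0 then 0 else int (inter_num adj i 1 (i - 1)))"

definition inter_b :: "('a::finite \<Rightarrow> 'a \<Rightarrow> bool) \<Rightarrow> nat \<Rightarrow> int" where
  "inter_b adj i = (if i = diam adj then 0 else int (inter_num adj i 1 (i + 1)))"

definition Delta :: "('a::finite \<Rightarrow> 'a \<Rightarrow> bool) \<Rightarrow> nat \<Rightarrow> int" where
  "Delta adj i = (inter_b adj (i - 1) - 1) * (inter_c adj (i + 1) - 1)
     - (inter_c adj 2 - 1) * int (inter_num adj i 2 i)"


section \<open>The Terwilliger algebra and its modules\<close>

definition adj_matrix :: "('a::finite \<Rightarrow> 'a \<Rightarrow> bool) \<Rightarrow> complex^'a^'a" where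
  "adj_matrix adj = (\<chi> u v. if adj u v then 1 else 0)"

definition dual_idem :: "('a::finite \<Rightarrow> 'a \<Rightarrow> bool) \<Rightarrow> 'a \<Rightarrow> nat \<Rightarrow> complex^'a^'a" where
  "dual_idem adj x i = (\<chi> u v. if u = v \<and> gdist adj x u = i then 1 else 0)"

definition matrix_subalgebra :: "(complex^'a^'a::finite) set \<Rightarrow> bool" where
  "matrix_subalgebra S \<longleftrightarrow> mat 1 \<in> S \<and> (\<forall>A\<in>S. \<forall>B\<in>S. A + B \<in> S \<and> A ** B \<in> S) \<and>
     (\<forall>a. \<forall>B\<in>S. (\<chi> u v. a * B $ u $ v) \<in> S)"

definition terwilliger_algebra ::
    "('a::finite \<Rightarrow> 'a \<Rightarrow> bool) \<Rightarrow> 'a \<Rightarrow> (complex^'a^'a) set" where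
  "terwilliger_algebra adj x =
     matrix_subalgebra hull (insert (adj_matrix adj) (dual_idem adj x ` {..diam adj}))"

definition T_module ::
    "('a::finite \<Rightarrow> 'a \<Rightarrow> bool) \<Rightarrow> 'a \<Rightarrow> (complex^'a) set \<Rightarrow> bool" where
  "T_module adj x W \<longleftrightarrow> vec.subspace W \<and>
     (\<forall>B\<in>terwilliger_algebra adj x. \<forall>w\<in>W. B *v w \<in> W)"

definition irreducible_T_module ::
    "('a::finite \<Rightarrow> 'a \<Rightarrow> bool) \<Rightarrow> 'a \<Rightarrow> (complex^'a) set \<Rightarrow> bool" where
  "irreducible_T_module adj x W \<longleftrightarrow> T_module adj x W \<and> W \<noteq> {0} \<and>
     (\<forall>U. T_module adj x U \<and> U \<subseteq> W \<longrightarrow> U = {0} \<or> U = W)"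

definition T_isomorphic ::
    "('a::finite \<Rightarrow> 'a \<Rightarrow> bool) \<Rightarrow> 'a \<Rightarrow> (complex^'a) set \<Rightarrow> (complex^'a) set \<Rightarrow> bool" where
  "T_isomorphic adj x W W' \<longleftrightarrow> (\<exists>\<sigma>. bij_betw \<sigma> W W' \<and>
     (\<forall>v\<in>W. \<forall>w\<in>W. \<sigma> (v + w) = \<sigma> v + \<sigma> w) \<and>
     (\<forall>a. \<forall>w\<in>W. \<sigma> (a *s w) = a *s \<sigma> w) \<and>
     (\<forall>B\<in>terwilliger_algebra adj x. \<forall>w\<in>W. \<sigma> (B *v w) = B *v \<sigma> w))"

definition endpoint ::
    "('a::finite \<Rightarrow> 'a \<Rightarrow> bool) \<Rightarrow> 'a \<Rightarrow> (complex^'a) set \<Rightarrow> nat" where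
  "endpoint adj x W = (LEAST i. (*v) (dual_idem adj x i) ` W \<noteq> {0})"

definition thin ::
    "('a::finite \<Rightarrow> 'a \<Rightarrow> bool) \<Rightarrow> 'a \<Rightarrow> (complex^'a) set \<Rightarrow> bool" where
  "thin adj x W \<longleftrightarrow> (\<forall>i\<le>diam adj. vec.dim ((*v) (dual_idem adj x i) ` W) \<le> 1)"

definition exactly_two_irreducible_endpoint_two ::
    "('a::finite \<Rightarrow> 'a \<Rightarrow> bool) \<Rightarrow> 'a \<Rightarrow> bool" where
  "exactly_two_irreducible_endpoint_two adj x \<longleftrightarrow>
     (\<exists>W\<^sub>1 W\<^sub>2. irreducible_T_module adj x W\<^sub>1 \<and> endpoint adj x W\<^sub>1 = 2 \<and>
        irreducible_T_module adj x W\<^sub>2 \<and> endpoint adj x W\<^sub>2 = 2 \<and>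
        \<not> T_isomorphic adj x W\<^sub>1 W\<^sub>2 \<and>
        (\<forall>W. irreducible_T_module adj x W \<and> endpoint adj x W = 2 \<longrightarrow>
           T_isomorphic adj x W W\<^sub>1 \<or> T_isomorphic adj x W W\<^sub>2))"

end

theory Submission
  imports Defs
begin

text \<open>
  Counting, for a fixed pair \<open>x, z\<close> at distance \<open>i\<close>, over the \<open>y\<close> adjacent to a fixed neighbour \<open>w\<close> of
  \<open>x\<close> turns the relation between \<open>\<alpha>\<^sub>i\<close> and \<open>\<beta>\<^sub>i\<close> into two linear equations, one for \<open>w\<close> closer to \<open>z\<close>
  and one for \<open>w\<close> farther away; their determinant is \<open>c\<^sub>2 \<Delta>\<^sub>i\<close>. The same counts give the first two
  moments of \<open>|\<Gamma>(x) \<inter> \<Gamma>(y) \<inter> \<Gamma>\<^sub>i\<^sub>-\<^sub>1(z)|\<close> over \<open>y \<in> \<Gamma>\<^sub>2(x) \<inter> \<Gamma>\<^sub>i(z)\<close>; their variance is a positive multiple of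
  \<open>\<Delta>\<^sub>i\<close>, so \<open>\<Delta>\<^sub>i \<ge> 0\<close>, and \<open>\<Delta>\<^sub>i = 0\<close> makes this number constant.

  A thin irreducible module \<open>W\<close> with endpoint 2 is spanned by the vectors \<open>E\<^sup>*\<^sub>i A\<^sub>i\<^sub>-\<^sub>2 v\<close> with
  \<open>v \<in> E\<^sup>*\<^sub>2 W\<close>, and \<open>E\<^sup>*\<^sub>i A\<^sub>i v = (s\<^sub>i - 1) E\<^sup>*\<^sub>i A\<^sub>i\<^sub>-\<^sub>2 v\<close> for real \<open>s\<^sub>i\<close>. The numbers \<open>s\<^sub>i\<close> are determined by
  \<open>s\<^sub>2\<close>, and \<open>s\<^sub>2\<close> determines \<open>W\<close> up to isomorphism. They satisfy the Riccati recurrence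
  \<open>b\<^sub>i b\<^sub>i\<^sub>+\<^sub>1 / s\<^sub>i = c\<^sub>i\<^sub>-\<^sub>1 b\<^sub>i + b\<^sub>i\<^sub>-\<^sub>1 c\<^sub>i\<^sub>-\<^sub>2 - c\<^sub>i\<^sub>-\<^sub>2 c\<^sub>i\<^sub>-\<^sub>3 s\<^sub>i\<^sub>-\<^sub>2 - \<psi>\<close> with \<open>\<psi> = b\<^sub>2 - b\<^sub>2 b\<^sub>3 / s\<^sub>2\<close>, which makes
  \<open>s\<^sub>i\<close> a strictly monotone function of \<open>s\<^sub>2\<close> on either side of 0; hence \<open>s\<^sub>2 \<mapsto> s\<^sub>i\<close> is injective for \<open>i \<le> D - 2\<close>.
  If \<open>\<Delta>\<^sub>i = 0\<close>, then \<open>E\<^sup>*\<^sub>i A\<^sub>i\<^sub>-\<^sub>2 v\<close> and \<open>E\<^sup>*\<^sub>i A\<^sub>i v\<close> satisfy a linear relation that does not depend on \<open>W\<close>, so all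
  such modules have the same \<open>s\<^sub>i\<close> and are isomorphic, contrary to the existence of two of them.
\<close>

section \<open>Distances and intersection numbers\<close>

lemma sum_card_swap:
  assumes "finite A" "finite B"
  shows "(\<Sum>a\<in>A. card {y\<in>B. R a y}) = (\<Sum>y\<in>B. card {a\<in>A. R a y})"
proof -
  have "(\<Sum>a\<in>A. card {y\<in>B. R a y}) = (\<Sum>a\<in>A. \<Sum>y\<in>B. if R a y then 1 else 0)"
    using assms by (simp add: sum.If_cases Int_def)
  also have "\<dots> = (\<Sum>y\<in>B. \<Sum>a\<in>A. if R a y then 1 else 0)" by (rule sum.swap)
  also have "\<dots> = (\<Sum>y\<in>B. card {a\<in>A. R a y})"
    using assms by (simp add: sum.If_cases Int_def)
  finally show ?thesis .
qed

locale bipartite_drg =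
  fixes adj :: "'a::finite \<Rightarrow> 'a \<Rightarrow> bool"
  assumes distance_regular: "distance_regular adj"
    and bipartite: "bipartite_graph adj"
begin

abbreviation d :: "'a \<Rightarrow> 'a \<Rightarrow> nat" where "d \<equiv> gdist adj"
abbreviation D :: nat where "D \<equiv> diam adj"
abbreviation c :: "nat \<Rightarrow> int" where "c \<equiv> inter_c adj"
abbreviation b :: "nat \<Rightarrow> int" where "b \<equiv> inter_b adj"

lemma adj_sym: "adj x y \<longleftrightarrow> adj y x"
  using distance_regular by (auto simp: distance_regular_def simple_graph_def)

lemma adj_irrefl [simp]: "\<not> adj x x"
  using distance_regular by (auto simp: distance_regular_def simple_graph_def)

lemma walk_exists: "\<exists>n. (adj ^^ n) x y"
proof -
  have "adj\<^sup>*\<^sup>* x y"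
    using distance_regular by (simp add: distance_regular_def connected_graph_def)
  then show ?thesis by (simp add: rtranclp_power)
qed

lemma shortest_walk: "(adj ^^ d x y) x y"
  unfolding gdist_def by (rule LeastI_ex) (rule walk_exists)

lemma gdist_le: "(adj ^^ n) x y \<Longrightarrow> d x y \<le> n"
  unfolding gdist_def by (rule Least_le)

lemma gdist_eq_0 [simp]: "d x y = 0 \<longleftrightarrow> x = y"
proof
  assume "d x y = 0"
  then show "x = y" using shortest_walk[of x y] by simp
next
  assume "x = y"
  then show "d x y = 0" using gdist_le[of 0 x y] by simp
qed

lemma walk_sym: "(adj ^^ n) x y \<Longrightarrow> (adj ^^ n) y x"
proof (induction n arbitrary: x y)
  case (Suc n)
  then obtain w where "(adj ^^ n) x w" "adj w y" by auto
  then show ?case using Suc.IH adj_sym by (metis relpowp_Suc_I2)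
qed simp

lemma gdist_sym: "d x y = d y x"
  by (meson shortest_walk walk_sym gdist_le order_antisym)

lemma gdist_triangle: "d x z \<le> d x y + d y z"
proof -
  have "(adj ^^ (d x y + d y z)) x z"
    using shortest_walk[of x y] shortest_walk[of y z] by (auto simp: relpowp_add)
  then show ?thesis by (rule gdist_le)
qed

lemma adj_iff_gdist: "adj x y \<longleftrightarrow> d x y = 1"
proof
  assume "adj x y"
  then have "d x y \<le> 1" "x \<noteq> y" using gdist_le[of 1 x y] by auto
  then show "d x y = 1" using gdist_eq_0[of x y] by linarith
next
  assume "d x y = 1"
  then show "adj x y" using shortest_walk[of x y] by (simp add: eq_OO)
qed

lemma gdist_predecessor: "d x y = Suc n \<Longrightarrow> \<exists>w. adj y w \<and> d x w = n"
proof -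
  assume h: "d x y = Suc n"
  then obtain w where w: "(adj ^^ n) x w" "adj w y" using shortest_walk[of x y] by auto
  then have "d x w \<le> n" "d w y = 1" using gdist_le adj_iff_gdist by auto
  then have "d x w = n" using gdist_triangle[of x y w] h by simp
  then show ?thesis using w adj_sym by auto
qed

lemma walk_parity: "\<exists>S. \<forall>n x y. (adj ^^ n) x y \<longrightarrow> ((x \<in> S \<longleftrightarrow> y \<in> S) \<longleftrightarrow> even n)"
proof -
  obtain S where S: "\<And>x y. adj x y \<Longrightarrow> (x \<in> S \<longleftrightarrow> y \<notin> S)"
    using bipartite by (auto simp: bipartite_graph_def)
  have "(adj ^^ n) x y \<Longrightarrow> ((x \<in> S \<longleftrightarrow> y \<in> S) \<longleftrightarrow> even n)" for n x y
    by (induction n arbitrary: y) (use S in \<open>auto elim!: relcomppE\<close>)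
  then show ?thesis by blast
qed

text \<open>Three shortest walks close up to a closed walk, which has even length in a bipartite
  graph. Later exclusions of intermediate distances rest on this parity.\<close>

lemma even_gdist_add: "even (d x y + d y z + d x z)"
proof -
  obtain S where "\<And>n x y. (adj ^^ n) x y \<Longrightarrow> ((x \<in> S \<longleftrightarrow> y \<in> S) \<longleftrightarrow> even n)"
    using walk_parity by blast
  then show ?thesis
    using shortest_walk[of x y] shortest_walk[of y z] shortest_walk[of x z] by (metis even_add)
qed

lemma adj_gdist: "adj u w \<Longrightarrow> d x u = Suc (d x w) \<or> d x w = Suc (d x u)"
proof -
  assume "adj u w"
  then have "d u w = 1" "d w u = 1" using adj_iff_gdist gdist_sym by auto
  moreover from this have "d x u \<noteq> d x w" using even_gdist_add[of x u w] by auto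
  ultimately show ?thesis
    using gdist_triangle[of x u w] gdist_triangle[of x w u] by linarith
qed

section \<open>Diameter and intersection numbers\<close>

lemma finite_distances: "finite {d x y | x y. True}"
proof -
  have "{d x y | x y. True} = (\<lambda>(x, y). d x y) ` UNIV" by auto
  then show ?thesis by (metis finite finite_imageI)
qed

lemma gdist_le_diam: "d x y \<le> D"
  unfolding diam_def by (rule Max_ge[OF finite_distances]) auto

lemma gdist_attained: "i \<le> D \<Longrightarrow> \<exists>x y. d x y = i"
proof (induction rule: inc_induct)
  case base
  have "D \<in> {d x y | x y. True}"
    unfolding diam_def by (rule Max_in[OF finite_distances]) auto
  then show ?case by (smt (verit) mem_Collect_eq)
next
  case (step n)
  then show ?case using gdist_predecessor by metis
qed

lemma inter_num_eq:
  assumes "h \<le> D" "i \<le> D" "j \<le> D" "d u w = h"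
  shows "card {y. d u y = i \<and> d w y = j} = inter_num adj h i j"
proof -
  obtain n where n: "\<And>u w. d u w = h \<Longrightarrow> card (sphere_at adj i u \<inter> sphere_at adj j w) = n"
    using distance_regular assms unfolding distance_regular_def by metis
  have "inter_num adj h i j = n"
    unfolding inter_num_def using n assms by (intro the_equality) auto
  moreover have "{y. d u y = i \<and> d w y = j} = sphere_at adj i u \<inter> sphere_at adj j w"
    by (auto simp: sphere_at_def)
  ultimately show ?thesis using n assms by simp
qed

lemma card_c:
  assumes "d y z = Suc j"
  shows "int (card {u. adj z u \<and> d y u = j}) = c (Suc j)"
proof -
  have "Suc j \<le> D" using assms gdist_le_diam by metis
  moreover have "d z y = Suc j" using assms gdist_sym by metis
  ultimately show ?thesis
    using inter_num_eq[of "Suc j" 1 j z y] by (simp add: inter_c_def adj_iff_gdist)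
qed

lemma card_b:
  assumes "d y z = j"
  shows "int (card {u. adj z u \<and> d y u = Suc j}) = b j"
proof (cases "j = D")
  case True
  then have "{u. adj z u \<and> d y u = Suc j} = {}"
    using gdist_le_diam by (metis (mono_tags, lifting) Suc_n_not_le_n empty_Collect_eq)
  then show ?thesis using True by (simp add: inter_b_def)
next
  case False
  then have "Suc j \<le> D" using assms gdist_le_diam[of y z] by simp
  moreover have "d z y = j" using assms gdist_sym by metis
  ultimately show ?thesis using False
    using inter_num_eq[of j 1 "Suc j" z y] by (simp add: inter_b_def adj_iff_gdist)
qed

lemma c_0 [simp]: "c 0 = 0" by (simp add: inter_c_def)

lemma card_adj: "int (card {u. adj z u}) = b 0"
proof -
  have "{u. adj z u} = {u. adj z u \<and> d z u = Suc 0}" using adj_iff_gdist by auto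
  then show ?thesis using card_b[of z z 0] by simp
qed

lemma b_add_c: "j \<le> D \<Longrightarrow> b j + c j = b 0"
proof -
  assume "j \<le> D"
  then obtain y z where yz: "d y z = j" using gdist_attained by blast
  show ?thesis
  proof (cases j)
    case (Suc i)
    have "{u. adj z u} = {u. adj z u \<and> d y u = Suc j} \<union> {u. adj z u \<and> d y u = i}"
      using adj_gdist[of z _ y] yz Suc by auto
    moreover have "card ({u. adj z u \<and> d y u = Suc j} \<union> {u. adj z u \<and> d y u = i})
       = card {u. adj z u \<and> d y u = Suc j} + card {u. adj z u \<and> d y u = i}"
      using Suc by (intro card_Un_disjoint) auto
    ultimately show ?thesis
      using card_adj[of z] card_b[OF yz] card_c[of y z i] yz Suc by simp
  qed simp
qed

lemma c_pos: "j < D \<Longrightarrow> 0 < c (Suc j)"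
proof -
  assume "j < D"
  then obtain y z where yz: "d y z = Suc j" using gdist_attained[of "Suc j"] by auto
  then have "{u. adj z u \<and> d y u = j} \<noteq> {}" using gdist_predecessor by auto
  then show ?thesis using card_c[OF yz] by (metis card_gt_0_iff finite of_nat_0_less_iff)
qed

lemma b_pos: "j < D \<Longrightarrow> 0 < b j"
proof -
  assume "j < D"
  then obtain y z where yz: "d y z = Suc j" using gdist_attained[of "Suc j"] by auto
  then obtain w where w: "adj z w" "d y w = j" using gdist_predecessor by blast
  then have "{u. adj w u \<and> d y u = Suc j} \<noteq> {}" using yz adj_sym by auto
  then show ?thesis using card_b[OF w(2)] by (metis card_gt_0_iff finite of_nat_0_less_iff)
qed

lemma c_1: "0 < D \<Longrightarrow> c (Suc 0) = 1"
proof -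
  assume "0 < D"
  then obtain y z where yz: "d y z = Suc 0" using gdist_attained[of "Suc 0"] by auto
  then have "{u. adj z u \<and> d y u = 0} = {y}" using adj_iff_gdist adj_sym by auto
  then show ?thesis using card_c[OF yz] by simp
qed

lemma gdist_2I: "adj x w \<Longrightarrow> adj w y \<Longrightarrow> x \<noteq> y \<Longrightarrow> d x y = 2"
proof -
  assume "adj x w" "adj w y" and ne: "x \<noteq> y"
  then have "d x w = 1" "d w y = 1" using adj_iff_gdist by auto
  moreover from this have "even (d x y)" using even_gdist_add[of x w y] by simp
  moreover have "d x y \<noteq> 0" using ne by simp
  moreover have "d x y \<noteq> 1" using \<open>even (d x y)\<close> by auto
  ultimately show ?thesis using gdist_triangle[of x y w] by linarith
qed

lemma card_common: "d x y = 2 \<Longrightarrow> int (card {w. adj x w \<and> adj y w}) = c 2"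
  using card_c[of x y 1] by (simp add: numeral_2_eq_2 adj_iff_gdist conj_commute)

end

section \<open>Triple counts\<close>

context bipartite_drg
begin

text \<open>The level \<open>i - 1\<close>, where \<open>i = d x z\<close>, gives the count that
  \<open>\<beta>\<close> multiplies in the theorem. Below, \<open>i\<close> is written
  \<open>l + 2\<close>, so that the neighbouring levels are \<open>l + 1\<close> and
  \<open>l + 3\<close> without truncated subtraction.\<close>

definition common_near :: "'a \<Rightarrow> 'a \<Rightarrow> nat \<Rightarrow> 'a \<Rightarrow> nat" where
  "common_near x z l y = card {w. adj x w \<and> adj y w \<and> d z w = l}"

lemma card_neighbour_away:
  assumes "adj w x" "d z x = i" "d z w = Suc i \<or> i = Suc (d z w)"
  shows "int (card {y. adj w y \<and> d z y = i \<and> y \<noteq> x})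
    = (if d z w = Suc i then c (Suc i) else b (i - 1)) - 1"
proof -
  have eq: "{y. adj w y \<and> d z y = i} = insert x {y. adj w y \<and> d z y = i \<and> y \<noteq> x}"
    using assms(1,2) by auto
  have "card {y. adj w y \<and> d z y = i} = Suc (card {y. adj w y \<and> d z y = i \<and> y \<noteq> x})"
    unfolding eq by (rule card_insert_disjoint) auto
  then have "int (card {y. adj w y \<and> d z y = i})
      = int (card {y. adj w y \<and> d z y = i \<and> y \<noteq> x}) + 1" by simp
  moreover have "int (card {y. adj w y \<and> d z y = i}) = (if d z w = Suc i then c (Suc i) else b (i - 1))"
    using assms(3) card_c[of z w i] card_b[of z w "i - 1"] by auto
  ultimately show ?thesis by simp
qed

context
  fixes x z :: 'a and l :: nat
  assumes xz: "d x z = l + 2"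
begin

private lemma zx: "d z x = l + 2" using xz gdist_sym by metis

lemma near_between:
  assumes "d z v = l" "adj w v" "adj x w"
  shows "d z w = l + 1"
  using adj_gdist[OF assms(2), of z] adj_gdist[OF assms(3), of z] assms(1) zx by linarith

text \<open>The \<open>c 2\<close> common neighbours of \<open>w\<close> and \<open>w'\<close> lie
  at distance \<open>l\<close> or \<open>l + 2\<close> from \<open>z\<close>, and \<open>x\<close>
  is one of the latter. Counting at level \<open>l + 2\<close> is thereby traded for counting at
  level \<open>l\<close>.\<close>

lemma card_common_via:
  assumes w: "adj x w" "d z w = l + 1" and w': "adj x w'" "d z w' = l + 1" "w' \<noteq> w"
  shows "int (card {y. adj w y \<and> d z y = l + 2 \<and> y \<noteq> x \<and> adj w' y})
    = c 2 - 1 - int (card {v. adj w v \<and> d z v = l \<and> adj w' v})"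
proof -
  have ww': "d w w' = 2" using gdist_2I[of w x w'] w w' adj_sym by auto
  have split: "{u. adj w u \<and> adj w' u} = insert x ({y. adj w y \<and> d z y = l + 2 \<and> y \<noteq> x \<and> adj w' y}
      \<union> {v. adj w v \<and> d z v = l \<and> adj w' v})" (is "?C = insert x (?Y \<union> ?V)")
  proof -
    have "d z u = l + 2 \<or> d z u = l" if "adj w u" for u
      using adj_gdist[OF that, of z] w(2) by linarith
    then show ?thesis using w w' adj_sym by auto
  qed
  have "x \<notin> ?Y \<union> ?V" using zx by auto
  then have "card ?C = 1 + card (?Y \<union> ?V)" using split by simp
  also have "card (?Y \<union> ?V) = card ?Y + card ?V" by (rule card_Un_disjoint) auto
  finally have "card ?C = 1 + (card ?Y + card ?V)" .
  then show ?thesis using card_common[OF ww'] by linarith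
qed

text \<open>Double counting of the edges between the \<open>y\<close> and the neighbours
  \<open>w'\<close> of \<open>x\<close> in \<open>?L\<close>. The term \<open>w' = w\<close>
  contributes all of \<open>?Y\<close>; for the others \<open>card_common_via\<close> passes to
  vertices \<open>v\<close> at level \<open>l\<close>.\<close>

lemma sum_common_near_inner:
  assumes w: "adj x w" "d z w = l + 1"
  shows "(\<Sum>y\<in>{y. adj w y \<and> d z y = l + 2 \<and> y \<noteq> x}. int (common_near x z (l + 1) y))
    = (b (l + 1) - 1) + (c (l + 2) - 1 - c (l + 1)) * (c 2 - 1)" (is "?lhs = _")
proof -
  let ?Y = "{y. adj w y \<and> d z y = l + 2 \<and> y \<noteq> x}" and ?L = "{w'. adj x w' \<and> d z w' = l + 1}"
  let ?V = "{v. adj w v \<and> d z v = l}"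
  have wL: "w \<in> ?L" using w by simp
  have cL: "int (card ?L) = c (l + 2)" using card_c[of z x "l + 1"] zx by simp
  have cV: "int (card ?V) = c (l + 1)" using card_c[of z w l] w by simp
  have "card ?L = Suc (card (?L - {w}))" using wL by (intro card.remove) auto
  then have cLw: "int (card (?L - {w})) = c (l + 2) - 1" using cL by simp
  have "?lhs = int (\<Sum>y\<in>?Y. card {w'\<in>?L. adj w' y})"
    by (simp add: common_near_def adj_sym conj_commute conj_left_commute)
  also have "\<dots> = int (\<Sum>w'\<in>?L. card {y\<in>?Y. adj w' y})"
    by (subst sum_card_swap) auto
  also have "\<dots> = int (card {y\<in>?Y. adj w y}) + (\<Sum>w'\<in>?L - {w}. int (card {y\<in>?Y. adj w' y}))"
    using wL by (subst sum.remove[of _ w]) auto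
  also have "{y\<in>?Y. adj w y} = ?Y" by auto
  also have "int (card ?Y) = b (l + 1) - 1"
    using card_neighbour_away[of w x z "l + 2"] w zx adj_sym by simp
  also have "(\<Sum>w'\<in>?L - {w}. int (card {y\<in>?Y. adj w' y}))
      = (\<Sum>w'\<in>?L - {w}. (c 2 - 1) - int (card {v\<in>?V. adj w' v}))"
    using card_common_via[OF w] by (intro sum.cong) (auto simp: conj_assoc)
  also have "\<dots> = (c (l + 2) - 1) * (c 2 - 1) - int (\<Sum>w'\<in>?L - {w}. card {v\<in>?V. adj w' v})"
    using cLw by (simp add: sum_subtractf)
  also have "(\<Sum>w'\<in>?L - {w}. card {v\<in>?V. adj w' v}) = (\<Sum>v\<in>?V. card {w'\<in>?L - {w}. adj w' v})"
    by (rule sum_card_swap) auto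
  \<comment> \<open>Such a \<open>v\<close> is at distance 2 from \<open>x\<close>, and by
    \<open>near_between\<close> all \<open>c 2\<close> common neighbours of \<open>x\<close> and
    \<open>v\<close> lie in \<open>?L\<close>; one of them is \<open>w\<close>.\<close>
  also have "int \<dots> = (\<Sum>v\<in>?V. c 2 - 1)"
  proof -
    have "int (card {w'\<in>?L - {w}. adj w' v}) = c 2 - 1" if v: "v \<in> ?V" for v
    proof -
      have "x \<noteq> v" using v zx by auto
      then have "d x v = 2" using gdist_2I[of x w v] w v by auto
      moreover have "{w'. adj x w' \<and> adj v w'} = insert w {w'\<in>?L - {w}. adj w' v}"
        using near_between v w adj_sym by auto
      ultimately have "int (card (insert w {w'\<in>?L - {w}. adj w' v})) = c 2"
        using card_common by metis
      then show ?thesis by (subst (asm) card_insert_disjoint) auto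
    qed
    then show ?thesis by simp
  qed
  finally show ?thesis using cV by (simp add: algebra_simps)
qed

text \<open>Double counting against the neighbours \<open>u\<close> of \<open>z\<close> in
  \<open>?K\<close>, split by \<open>d w u\<close>. If \<open>d w u = l\<close>, every
  \<open>y\<close> qualifies. If \<open>d w u = l + 2\<close>, the \<open>c (l + 2)\<close>
  neighbours of \<open>w\<close> at distance \<open>l + 1\<close> from \<open>u\<close> are
  \<open>x\<close>, the \<open>c (l + 1)\<close> neighbours of \<open>w\<close> at level
  \<open>l\<close>, and the wanted \<open>y\<close>.\<close>

lemma sum_common_dual_inner:
  assumes w: "adj x w" "d z w = l + 1"
  shows "(\<Sum>y\<in>{y. adj w y \<and> d z y = l + 2 \<and> y \<noteq> x}. int (card {u. adj z u \<and> d x u = l + 1 \<and> d y u = l + 1}))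
    = c (l + 1) * (b (l + 1) - 1) + (c (l + 2) - c (l + 1)) * (c (l + 2) - c (l + 1) - 1)" (is "?lhs = _")
proof -
  let ?Y = "{y. adj w y \<and> d z y = l + 2 \<and> y \<noteq> x}" and ?K = "{u. adj z u \<and> d x u = l + 1}"
  let ?K1 = "{u. adj z u \<and> d w u = l}" and ?K2 = "{u. adj z u \<and> d x u = l + 1 \<and> d w u = l + 2}"
  have wz: "d w z = l + 1" using w gdist_sym by metis
  have K1: "d x u = l + 1" if "adj z u" "d w u = l" for u
    using adj_gdist[OF that(1), of x] adj_gdist[OF w(1), of u] that xz gdist_sym[of u x] gdist_sym[of u w]
    by linarith
  have K: "?K = ?K1 \<union> ?K2"
  proof -
    have "d w u = l \<or> d w u = l + 2" if "adj z u" for u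
      using adj_gdist[OF that, of w] wz by linarith
    then show ?thesis using K1 by auto
  qed
  have cK: "int (card ?K) = c (l + 2)" using card_c[of x z "l + 1"] xz by simp
  have cK1: "int (card ?K1) = c (l + 1)" using card_c[of w z l] wz by simp
  have "card ?K = card ?K1 + card ?K2" unfolding K by (rule card_Un_disjoint) auto
  then have cK2: "int (card ?K2) = c (l + 2) - c (l + 1)" using cK cK1 by simp
  have cY: "int (card ?Y) = b (l + 1) - 1"
    using card_neighbour_away[of w x z "l + 2"] w zx adj_sym by simp
  have "?lhs = int (\<Sum>y\<in>?Y. card {u\<in>?K. d y u = l + 1})" by (simp add: conj_assoc)
  also have "\<dots> = int (\<Sum>u\<in>?K. card {y\<in>?Y. d y u = l + 1})"
    by (subst sum_card_swap) auto
  also have "\<dots> = (\<Sum>u\<in>?K1. int (card {y\<in>?Y. d y u = l + 1})) + (\<Sum>u\<in>?K2. int (card {y\<in>?Y. d y u = l + 1}))"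
    unfolding K by (subst sum.union_disjoint) auto
  also have "(\<Sum>u\<in>?K1. int (card {y\<in>?Y. d y u = l + 1})) = (\<Sum>u\<in>?K1. b (l + 1) - 1)"
  proof (intro sum.cong refl)
    fix u assume u: "u \<in> ?K1"
    have "d y u = l + 1" if "adj w y" "d z y = l + 2" for y
    proof -
      have "adj z u" "d w u = l" using u by auto
      then show ?thesis
        using adj_gdist[of z u y] adj_gdist[of w y u] that
          gdist_sym[of u y] gdist_sym[of u w] gdist_sym[of z y] by linarith
    qed
    then have "{y\<in>?Y. d y u = l + 1} = ?Y" by auto
    then show "int (card {y\<in>?Y. d y u = l + 1}) = b (l + 1) - 1" using cY by simp
  qed
  also have "(\<Sum>u\<in>?K2. int (card {y\<in>?Y. d y u = l + 1})) = (\<Sum>u\<in>?K2. c (l + 2) - c (l + 1) - 1)"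
  proof (intro sum.cong refl)
    fix u assume u: "u \<in> ?K2"
    let ?Z = "{y. adj w y \<and> d z y = l}" and ?Y' = "{y\<in>?Y. d y u = l + 1}"
    have uw: "d u w = l + 2" using u gdist_sym[of u] by auto
    have Z: "d y u = l + 1" if "adj w y" "d z y = l" for y
    proof -
      have "adj z u" "d u w = l + 2" using u uw by auto
      then show ?thesis
        using adj_gdist[of z u y] adj_gdist[of w y u] that gdist_sym[of u y] gdist_sym[of z y] by linarith
    qed
    have "d z y = l \<or> d z y = l + 2" if "adj w y" for y
      using adj_gdist[OF that, of z] w by linarith
    then have eq: "{y. adj w y \<and> d u y = l + 1} = insert x (?Z \<union> ?Y')"
      using Z u w gdist_sym[of u] adj_sym by auto
    have "card (insert x (?Z \<union> ?Y')) = Suc (card (?Z \<union> ?Y'))"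
      using zx by (intro card_insert_disjoint) auto
    also have "card (?Z \<union> ?Y') = card ?Z + card ?Y'" by (rule card_Un_disjoint) auto
    finally have "card {y. adj w y \<and> d u y = l + 1} = Suc (card ?Z + card ?Y')" using eq by simp
    moreover have "int (card {y. adj w y \<and> d u y = l + 1}) = c (l + 2)"
      using card_c[of u w "l + 1"] uw by simp
    moreover have "int (card ?Z) = c (l + 1)" using card_c[of z w l] w by simp
    ultimately show "int (card ?Y') = c (l + 2) - c (l + 1) - 1" by simp
  qed
  finally show ?thesis using cK1 cK2 by simp
qed

text \<open>A common neighbour of \<open>w\<close> and \<open>w'\<close> sits between levels
  \<open>l + 3\<close> and \<open>l + 1\<close>, hence on level \<open>l + 2\<close>; so each
  \<open>w'\<close> contributes all \<open>c 2\<close> of them except \<open>x\<close>.\<close>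

lemma sum_common_near_outer:
  assumes w: "adj x w" "d z w = l + 3"
  shows "(\<Sum>y\<in>{y. adj w y \<and> d z y = l + 2 \<and> y \<noteq> x}. int (common_near x z (l + 1) y))
    = c (l + 2) * (c 2 - 1)" (is "?lhs = _")
proof -
  let ?Y = "{y. adj w y \<and> d z y = l + 2 \<and> y \<noteq> x}" and ?L = "{w'. adj x w' \<and> d z w' = l + 1}"
  have cL: "int (card ?L) = c (l + 2)" using card_c[of z x "l + 1"] zx by simp
  have "?lhs = int (\<Sum>y\<in>?Y. card {w'\<in>?L. adj w' y})"
    by (simp add: common_near_def adj_sym conj_commute conj_left_commute)
  also have "\<dots> = (\<Sum>w'\<in>?L. int (card {y\<in>?Y. adj w' y}))"
    by (subst sum_card_swap) auto
  also have "\<dots> = (\<Sum>w'\<in>?L. c 2 - 1)"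
  proof (intro sum.cong refl)
    fix w' assume w': "w' \<in> ?L"
    have "w \<noteq> w'" using w w' by auto
    then have "d w w' = 2" using gdist_2I[of w x w'] w w' adj_sym by auto
    moreover have "{y. adj w y \<and> adj w' y} = insert x {y\<in>?Y. adj w' y}"
    proof -
      have "d z y = l + 2" if "adj w y" "adj w' y" for y
        using adj_gdist[OF that(1), of z] adj_gdist[OF that(2), of z] w w' by simp linarith
      then show ?thesis using w w' adj_sym by auto
    qed
    ultimately have "int (card (insert x {y\<in>?Y. adj w' y})) = c 2" using card_common by metis
    then show "int (card {y\<in>?Y. adj w' y}) = c 2 - 1" by (subst (asm) card_insert_disjoint) auto
  qed
  finally show ?thesis using cL by simp
qed

text \<open>Each \<open>u\<close> in \<open>?K\<close> is at distance \<open>l + 2\<close> from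
  \<open>w\<close>, and the neighbours of \<open>w\<close> at distance \<open>l + 1\<close> from
  \<open>u\<close> are forced to level \<open>l + 2\<close>; discarding \<open>x\<close> leaves
  \<open>c (l + 2) - 1\<close>.\<close>

lemma sum_common_dual_outer:
  assumes w: "adj x w" "d z w = l + 3"
  shows "(\<Sum>y\<in>{y. adj w y \<and> d z y = l + 2 \<and> y \<noteq> x}. int (card {u. adj z u \<and> d x u = l + 1 \<and> d y u = l + 1}))
    = c (l + 2) * (c (l + 2) - 1)" (is "?lhs = _")
proof -
  let ?Y = "{y. adj w y \<and> d z y = l + 2 \<and> y \<noteq> x}" and ?K = "{u. adj z u \<and> d x u = l + 1}"
  have cK: "int (card ?K) = c (l + 2)" using card_c[of x z "l + 1"] xz by simp
  have wz: "d w z = l + 3" using w gdist_sym by metis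
  have "?lhs = int (\<Sum>y\<in>?Y. card {u\<in>?K. d y u = l + 1})" by (simp add: conj_assoc)
  also have "\<dots> = (\<Sum>u\<in>?K. int (card {y\<in>?Y. d y u = l + 1}))"
    by (subst sum_card_swap) auto
  also have "\<dots> = (\<Sum>u\<in>?K. c (l + 2) - 1)"
  proof (intro sum.cong refl)
    fix u assume u: "u \<in> ?K"
    have uw: "d u w = l + 2"
      using adj_gdist[of z u w] adj_gdist[OF w(1), of u] u wz gdist_sym[of u w] gdist_sym[of u x]
      by simp linarith
    have "d z y = l + 2" if "adj w y" "d u y = l + 1" for y
      using adj_gdist[OF that(1), of z] adj_gdist[of z u y] that u w gdist_sym[of y u] gdist_sym[of y z]
      by simp linarith
    then have "{y. adj w y \<and> d u y = l + 1} = insert x {y\<in>?Y. d y u = l + 1}"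
      using u w gdist_sym[of u] adj_sym by auto
    moreover have "int (card {y. adj w y \<and> d u y = l + 1}) = c (l + 2)"
      using card_c[of u w "l + 1"] uw by simp
    ultimately have "int (card (insert x {y\<in>?Y. d y u = l + 1})) = c (l + 2)" by simp
    then show "int (card {y\<in>?Y. d y u = l + 1}) = c (l + 2) - 1"
      by (subst (asm) card_insert_disjoint) auto
  qed
  finally show ?thesis using cK by simp
qed

section \<open>Moments of the common-neighbour count\<close>

abbreviation same_level :: "'a set" where "same_level \<equiv> {y. d x y = 2 \<and> d z y = l + 2}"

lemma common_split:
  assumes "y \<in> same_level"
  shows "int (common_near x z (l + 1) y) + int (common_near x z (l + 3) y) = c 2"
proof -
  have y: "d x y = 2" "d z y = l + 2" using assms by auto
  have "d z w = l + 1 \<or> d z w = l + 3" if "adj x w" for w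
    using adj_gdist[OF that, of z] zx by linarith
  then have "{w. adj x w \<and> adj y w} = {w. adj x w \<and> adj y w \<and> d z w = l + 1}
      \<union> {w. adj x w \<and> adj y w \<and> d z w = l + 3}" (is "?U = ?V \<union> ?W") by blast
  moreover have "card (?V \<union> ?W) = card ?V + card ?W" by (rule card_Un_disjoint) auto
  ultimately show ?thesis using card_common[OF y(1)] by (simp add: common_near_def)
qed

text \<open>Double counting of the paths \<open>x, w, y\<close> with a weight on \<open>y\<close>. A
  constant \<open>f\<close> gives the first moment; taking the count itself for \<open>f\<close>
  gives the second, with inner sums known from \<open>sum_common_near_inner\<close>.\<close>

lemma sum_common_weighted:
  "(\<Sum>y\<in>same_level. int (common_near x z m y) * f y)
    = (\<Sum>w\<in>{w. adj x w \<and> d z w = m}. \<Sum>y\<in>{y. adj w y \<and> d z y = l + 2 \<and> y \<noteq> x}. f y)"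
proof -
  let ?L = "{w. adj x w \<and> d z w = m}"
  have "(\<Sum>y\<in>same_level. int (common_near x z m y) * f y)
      = (\<Sum>y\<in>same_level. \<Sum>w\<in>?L. if adj w y then f y else 0)"
    by (simp add: sum.If_cases Int_def common_near_def adj_sym conj_commute conj_left_commute)
  also have "\<dots> = (\<Sum>w\<in>?L. \<Sum>y\<in>same_level. if adj w y then f y else 0)" by (rule sum.swap)
  also have "\<dots> = (\<Sum>w\<in>?L. \<Sum>y\<in>{y. adj w y \<and> d z y = l + 2 \<and> y \<noteq> x}. f y)"
  proof (rule sum.cong[OF refl])
    fix w assume w: "w \<in> ?L"
    have eq: "{y. adj w y \<and> d z y = l + 2 \<and> y \<noteq> x} = {y \<in> same_level. adj w y}"
    proof -
      have "d x x = 0" by simp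
      then have "d x x \<noteq> 2" by linarith
      then show ?thesis using gdist_2I[of x w] w by auto
    qed
    show "(\<Sum>y\<in>same_level. if adj w y then f y else 0)
        = (\<Sum>y\<in>{y. adj w y \<and> d z y = l + 2 \<and> y \<noteq> x}. f y)"
      unfolding eq by (simp add: sum.If_cases Int_def)
  qed
  finally show ?thesis .
qed

lemma card_lower: "int (card {w. adj x w \<and> d z w = l + 1}) = c (l + 2)"
  using card_c[of z x "l + 1"] zx by simp

lemma card_upper: "int (card {w. adj x w \<and> d z w = l + 3}) = b (l + 2)"
  using card_b[of z x "l + 2"] zx by (simp add: eval_nat_numeral)

lemma card_neighbours_lower:
  "adj x w \<Longrightarrow> d z w = l + 1 \<Longrightarrow> int (card {y. adj w y \<and> d z y = l + 2 \<and> y \<noteq> x}) = b (l + 1) - 1"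
  using card_neighbour_away[of w x z "l + 2"] zx adj_sym by simp

lemma card_neighbours_upper:
  "adj x w \<Longrightarrow> d z w = l + 3 \<Longrightarrow> int (card {y. adj w y \<and> d z y = l + 2 \<and> y \<noteq> x}) = c (l + 3) - 1"
  using card_neighbour_away[of w x z "l + 2"] zx adj_sym by (simp add: eval_nat_numeral)

lemma sum_common: "(\<Sum>y\<in>same_level. int (common_near x z (l + 1) y)) = c (l + 2) * (b (l + 1) - 1)"
proof -
  have "(\<Sum>y\<in>same_level. int (common_near x z (l + 1) y))
      = (\<Sum>w\<in>{w. adj x w \<and> d z w = l + 1}. int (card {y. adj w y \<and> d z y = l + 2 \<and> y \<noteq> x}))"
    using sum_common_weighted[of "l + 1" "\<lambda>_. 1"] by simp
  also have "\<dots> = (\<Sum>w\<in>{w. adj x w \<and> d z w = l + 1}. b (l + 1) - 1)"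
    by (rule sum.cong) (auto simp only: card_neighbours_lower mem_Collect_eq)
  finally show ?thesis using card_lower by simp
qed

lemma sum_common_square:
  "(\<Sum>y\<in>same_level. (int (common_near x z (l + 1) y))\<^sup>2)
    = c (l + 2) * ((b (l + 1) - 1) + (c (l + 2) - 1 - c (l + 1)) * (c 2 - 1))"
proof -
  have "(\<Sum>y\<in>same_level. (int (common_near x z (l + 1) y))\<^sup>2)
      = (\<Sum>w\<in>{w. adj x w \<and> d z w = l + 1}.
          \<Sum>y\<in>{y. adj w y \<and> d z y = l + 2 \<and> y \<noteq> x}. int (common_near x z (l + 1) y))"
    unfolding power2_eq_square by (rule sum_common_weighted)
  also have "\<dots> = (\<Sum>w\<in>{w. adj x w \<and> d z w = l + 1}.
      (b (l + 1) - 1) + (c (l + 2) - 1 - c (l + 1)) * (c 2 - 1))"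
    by (rule sum.cong) (auto simp only: sum_common_near_inner mem_Collect_eq)
  finally show ?thesis using card_lower by simp
qed

lemma card_same_level:
  "c 2 * int (card same_level) = c (l + 2) * (b (l + 1) - 1) + b (l + 2) * (c (l + 3) - 1)"
proof -
  have "c 2 * int (card same_level)
      = (\<Sum>y\<in>same_level. int (common_near x z (l + 1) y) + int (common_near x z (l + 3) y))"
    using common_split by simp
  also have "\<dots> = c (l + 2) * (b (l + 1) - 1) + (\<Sum>y\<in>same_level. int (common_near x z (l + 3) y))"
    by (simp only: sum.distrib sum_common)
  also have "(\<Sum>y\<in>same_level. int (common_near x z (l + 3) y)) = b (l + 2) * (c (l + 3) - 1)"
  proof -
    have "(\<Sum>y\<in>same_level. int (common_near x z (l + 3) y))
        = (\<Sum>w\<in>{w. adj x w \<and> d z w = l + 3}. int (card {y. adj w y \<and> d z y = l + 2 \<and> y \<noteq> x}))"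
      using sum_common_weighted[of "l + 3" "\<lambda>_. 1"] by simp
    also have "\<dots> = (\<Sum>w\<in>{w. adj x w \<and> d z w = l + 3}. c (l + 3) - 1)"
      by (rule sum.cong) (auto simp only: card_neighbours_upper mem_Collect_eq)
    finally show ?thesis using card_upper by simp
  qed
  finally show ?thesis .
qed

lemma card_same_level_eq: "l + 2 \<le> D \<Longrightarrow> 2 \<le> D \<Longrightarrow> card same_level = inter_num adj (l + 2) 2 (l + 2)"
  using inter_num_eq[of "l + 2" 2 "l + 2" x z] xz by simp

text \<open>For \<open>p > 0\<close> the count has mean
  \<open>c (l + 2) * (b (l + 1) - 1) / p\<close>, so this is a multiple of its variance; scaling by
  \<open>p\<close> keeps the identity in the integers.\<close>

lemma common_variance:
  assumes D: "l + 3 \<le> D"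
  defines "p \<equiv> int (card same_level)"
  shows "(\<Sum>y\<in>same_level. (p * int (common_near x z (l + 1) y) - c (l + 2) * (b (l + 1) - 1))\<^sup>2)
    = p * (c (l + 2) * (b (l + 2) * Delta adj (l + 2)))"
proof -
  define K where "K = c (l + 2) * (b (l + 1) - 1)"
  define M where "M = (b (l + 1) - 1) + (c (l + 2) - 1 - c (l + 1)) * (c 2 - 1)"
  let ?n = "\<lambda>y. int (common_near x z (l + 1) y)"
  have Delta: "Delta adj (l + 2) = (b (l + 1) - 1) * (c (l + 3) - 1) - (c 2 - 1) * p"
    using card_same_level_eq D by (simp add: Delta_def p_def eval_nat_numeral)
  have p: "c 2 * p = K + b (l + 2) * (c (l + 3) - 1)"
    using card_same_level by (simp add: p_def K_def)
  \<comment> \<open>Both sides are the valency. Eliminating \<open>c (l + 2) - c (l + 1)\<close>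
    brings the second moment to the shape in which \<open>Delta\<close> appears.\<close>
  have "b (l + 1) + c (l + 1) = b (l + 2) + c (l + 2)" using b_add_c D by simp
  then have "M = c 2 * (b (l + 1) - 1) - b (l + 2) * (c 2 - 1)"
    unfolding M_def by algebra
  then have M: "p * M - K * (b (l + 1) - 1) = b (l + 2) * Delta adj (l + 2)"
    unfolding Delta using p by algebra
  have "(\<Sum>y\<in>same_level. (p * ?n y - K)\<^sup>2)
      = (\<Sum>y\<in>same_level. p\<^sup>2 * (?n y)\<^sup>2 - 2 * p * K * ?n y + K\<^sup>2)"
    by (intro sum.cong) (auto simp: power2_eq_square algebra_simps)
  also have "\<dots> = p\<^sup>2 * (\<Sum>y\<in>same_level. (?n y)\<^sup>2) - 2 * p * K * (\<Sum>y\<in>same_level. ?n y) + p * K\<^sup>2"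
    by (simp add: sum.distrib sum_subtractf sum_distrib_left p_def)
  also have "\<dots> = p * (c (l + 2) * (p * M - K * (b (l + 1) - 1)))"
    unfolding sum_common sum_common_square M_def[symmetric] K_def by algebra
  finally show ?thesis unfolding M unfolding K_def .
qed

end

end

section \<open>A Riccati recurrence\<close>

text \<open>\<open>S n\<close>, \<open>N n\<close> and \<open>e n\<close> stand for \<open>s\<^sub>n\<^sub>+\<^sub>2\<close>, the squared norm of \<open>u\<^sub>n = E\<^sup>*\<^sub>n\<^sub>+\<^sub>2 A\<^sub>n v\<close>, and the coefficient
  of \<open>u\<^sub>n\<close> in \<open>A u\<^sub>n\<^sub>+\<^sub>1\<close>.\<close>

locale norm_recurrence =
  fixes b c :: "nat \<Rightarrow> real" and D :: nat and S N e :: "nat \<Rightarrow> real"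
  assumes b_pos: "\<And>j. j < D \<Longrightarrow> 0 < b j"
    and c_0: "c 0 = 0" and c_1: "c 1 = 1" and c_pos: "\<And>j. j < D \<Longrightarrow> 0 < c (Suc j)"
    and e_def: "\<And>n. e n = (if n = 0 then b 2 + c 2 * S 0
       else b (n + 2) + c (n + 2) * S n - c n * S (n - 1))"
    and N_0: "0 < N 0"
    and N_nonneg: "\<And>n. 0 \<le> N n"
    and N_Suc: "\<And>n. N n = 0 \<Longrightarrow> N (n + 1) = 0"
    and e_N: "\<And>n. n + 3 \<le> D \<Longrightarrow> N n \<noteq> 0 \<Longrightarrow> e n * N n = c (n + 1) * N (n + 1)"
    and S_rec: "\<And>n. n + 4 \<le> D \<Longrightarrow> N n \<noteq> 0 \<Longrightarrow> S (n + 1) * e n = b (n + 4) * S n"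
begin

text \<open>At a first zero \<open>N (m + 1)\<close> the coefficient \<open>e m\<close> would
  vanish, hence by \<open>S_rec\<close> also \<open>S m\<close> and, for \<open>m > 0\<close>,
  \<open>S (m - 1)\<close>. But then \<open>e m = b (m + 2) > 0\<close>.\<close>

lemma N_pos: "n + 4 \<le> D \<Longrightarrow> 0 < N n"
proof (induction n rule: less_induct)
  case (less n)
  show ?case
  proof (cases n)
    case 0
    then show ?thesis using N_0 by simp
  next
    case (Suc m)
    have pos: "0 < N j" if "j \<le> m" for j using less that Suc by simp
    have "N n \<noteq> 0"
    proof
      assume "N n = 0"
      then have e0: "e m = 0" using e_N[of m] pos[of m] less.prems Suc by simp
      then have Sm: "S m = 0" using S_rec[of m] pos[of m] less.prems Suc b_pos[of "m + 4"] by simp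
      have "e m = b (m + 2)"
      proof (cases m)
        case 0
        then show ?thesis using Sm e_def by (simp add: numeral_2_eq_2)
      next
        case m': (Suc l)
        then have "S l = 0" using S_rec[of l] Sm pos[of l] less.prems Suc b_pos[of "l + 4"] by simp
        then show ?thesis using Sm e_def[of m] m' by simp
      qed
      then show False using e0 b_pos[of "m + 2"] less.prems Suc by simp
    qed
    then show ?thesis using N_nonneg[of n] by simp
  qed
qed

lemma e_pos:
  assumes "n + 5 \<le> D"
  shows "0 < e n"
proof -
  have N: "0 < N n" "0 < N (n + 1)" using N_pos[of n] N_pos[of "n + 1"] assms by auto
  then have "0 < c (n + 1) * N (n + 1)" using c_pos[of n] assms by simp
  then have "0 < e n * N n" using e_N[of n] N assms by simp
  then show ?thesis using N by (simp add: zero_less_mult_iff)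
qed

text \<open>The factor \<open>b (n + 4) / e n\<close> is positive, which is why the sign of
  \<open>S 0\<close> persists.\<close>

lemma S_Suc: "n + 5 \<le> D \<Longrightarrow> S (Suc n) = b (n + 4) * S n / e n"
  using S_rec[of n] e_pos[of n] N_pos[of n] by (simp add: field_simps)

lemma S_zero: "S 0 = 0 \<Longrightarrow> n + 4 \<le> D \<Longrightarrow> S n = 0"
  by (induction n) (auto simp: S_Suc)

lemma S_positive: "0 < S 0 \<Longrightarrow> n + 4 \<le> D \<Longrightarrow> 0 < S n"
  by (induction n) (auto simp: S_Suc e_pos b_pos)

lemma S_negative: "S 0 < 0 \<Longrightarrow> n + 4 \<le> D \<Longrightarrow> S n < 0"
  by (induction n) (auto simp: S_Suc e_pos b_pos divide_neg_pos mult_pos_neg)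

text \<open>The conserved quantity \<open>\<psi>\<close> lets \<open>S n\<close> depend on \<open>S (n - 2)\<close> and \<open>\<psi>\<close> only.\<close>

definition psi :: real where "psi = b 2 - b 2 * b 3 / S 0"

lemma S_nz: "S 0 \<noteq> 0 \<Longrightarrow> n + 4 \<le> D \<Longrightarrow> S n \<noteq> 0"
  using S_positive[of n] S_negative[of n] by linarith

text \<open>By \<open>S_rec\<close>, the left side at \<open>n + 1\<close> is
  \<open>b (n + 3) * e n / S n\<close>. The part of \<open>e n\<close> containing
  \<open>S (n - 1)\<close> is turned into \<open>e (n - 1)\<close> by \<open>S_rec\<close> again,
  and the \<open>S (n - 2)\<close> term of the latter cancels the one of the induction
  hypothesis.\<close>

lemma riccati:
  assumes "S 0 \<noteq> 0" "n + 4 \<le> D"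
  shows "b (n + 2) * b (n + 3) / S n =
    c (n + 1) * b (n + 2) + b (n + 1) * c n - psi - (if n < 2 then 0 else c n * c (n - 1) * S (n - 2))"
  using assms(2)
proof (induction n)
  case 0
  then show ?case using c_0 c_1 by (simp add: psi_def eval_nat_numeral)
next
  case (Suc n)
  have nz: "S n \<noteq> 0" "S (Suc n) \<noteq> 0" using S_nz assms(1) Suc.prems by auto
  have rec: "S (Suc n) * e n = b (n + 4) * S n"
    using S_rec[of n] N_pos[of n] Suc.prems by simp
  have "b (n + 3) * b (n + 4) / S (Suc n) = b (n + 3) * e n / S n"
    using rec nz by (simp add: field_simps)
  also have "\<dots> = c (n + 2) * b (n + 3) + b (n + 2) * c (n + 1) - psi
      - (if Suc n < 2 then 0 else c (n + 1) * c n * S (n - 1))"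
  proof (cases n)
    case 0
    have "b 3 * e 0 / S 0 = b 2 * b 3 / S 0 + c 2 * b 3"
      using nz 0 by (simp add: e_def field_simps)
    then show ?thesis using 0 c_1 by (simp add: psi_def numeral_2_eq_2)
  next
    case (Suc l)
    have "S l \<noteq> 0" using S_nz assms(1) Suc.prems Suc by simp
    have "S n * e l = b (l + 4) * S l"
      using S_rec[of l] N_pos[of l] Suc.prems Suc by simp
    then have el: "b (n + 3) * S l / S n = e l" using nz Suc by (simp add: field_simps)
    have "b (n + 3) * e n / S n
        = b (n + 2) * b (n + 3) / S n + c (n + 2) * b (n + 3) - c n * (b (n + 3) * S l / S n)"
      using nz Suc by (simp add: e_def field_simps)
    also have "\<dots> = b (n + 2) * b (n + 3) / S n + c (n + 2) * b (n + 3) - c n * e l"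
      by (simp only: el)
    also have "b (n + 2) * b (n + 3) / S n = c (n + 1) * b (n + 2) + b (n + 1) * c n - psi
        - c n * (if l = 0 then 0 else c l * S (l - 1))"
      using Suc.IH Suc.prems Suc by auto
    also have "e l = b (n + 1) + c (n + 1) * S l - (if l = 0 then 0 else c l * S (l - 1))"
      using Suc by (simp add: e_def numeral_2_eq_2)
    finally show ?thesis using Suc by (simp add: algebra_simps)
  qed
  finally show ?case by (simp add: eval_nat_numeral)
qed

end


text \<open>The recurrences determine the data successively from \<open>S 0\<close>. The vanishing
  of \<open>N\<close> is compared as well, since \<open>N_pos\<close> stops at
  \<open>n = D - 4\<close> and the chain may end after that.\<close>

lemma norm_recurrence_unique:
  assumes "norm_recurrence b c D S N e" and "norm_recurrence b c D S' N' e'" and "S 0 = S' 0"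
    and "n + 2 \<le> D"
  shows "(N n = 0 \<longleftrightarrow> N' n = 0) \<and> (n + 3 \<le> D \<longrightarrow> N n \<noteq> 0 \<longrightarrow> S n = S' n \<and> e n = e' n)"
  using assms(4)
proof (induction n rule: less_induct)
  case (less n)
  interpret p: norm_recurrence b c D S N e by fact
  interpret q: norm_recurrence b c D S' N' e' by fact
  show ?case
  proof (cases n)
    case 0
    then show ?thesis using assms(3) p.N_0 q.N_0 p.e_def[of 0] q.e_def[of 0] by simp
  next
    case (Suc m)
    have IH: "N m = 0 \<longleftrightarrow> N' m = 0" "N m \<noteq> 0 \<Longrightarrow> S m = S' m \<and> e m = e' m"
      using less Suc by auto
    show ?thesis
    proof (cases "N m = 0")
      case True
      then show ?thesis using p.N_Suc[of m] q.N_Suc[of m] IH(1) Suc by simp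
    next
      case False
      have Sm: "S m = S' m" "e m = e' m" using IH(2)[OF False] by auto
      have N: "e m * N m = c n * N n" "e m * N' m = c n * N' n"
        using p.e_N[of m] q.e_N[of m] IH False less.prems Suc by auto
      have cn: "0 < c n" using p.c_pos[of m] less.prems Suc by simp
      have "N n = 0 \<longleftrightarrow> N' n = 0" using N cn False IH(1) by auto
      moreover have "S n = S' n \<and> e n = e' n" if n: "n + 3 \<le> D" "N n \<noteq> 0"
      proof -
        have "e m \<noteq> 0" using N(1) cn n(2) by auto
        moreover have "S n * e m = S' n * e m"
          using p.S_rec[of m] q.S_rec[of m] False IH(1) Sm n(1) Suc by simp
        ultimately have "S n = S' n" by simp
        then show ?thesis using p.e_def[of n] q.e_def[of n] Sm Suc by simp
      qed
      ultimately show ?thesis by blast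
    qed
  qed
qed

text \<open>On one side of 0, \<open>psi\<close> increases with \<open>S 0\<close>, so by
  \<open>riccati\<close> and the case \<open>n - 2\<close> the reciprocal \<open>1 / S n\<close>
  decreases. Inverting reverses the order because both values have the same sign.\<close>

lemma norm_recurrence_mono:
  assumes "norm_recurrence b c D S N e" and "norm_recurrence b c D S' N' e'"
    and "S 0 < S' 0" and "0 < S 0 \<or> S' 0 < 0" and "n + 4 \<le> D"
  shows "S n < S' n"
  using assms(5)
proof (induction n rule: less_induct)
  case (less n)
  interpret p: norm_recurrence b c D S N e by fact
  interpret q: norm_recurrence b c D S' N' e' by fact
  have sign: "0 < S m \<and> 0 < S' m \<or> S m < 0 \<and> S' m < 0" if "m + 4 \<le> D" for m
    using p.S_positive[of m] q.S_positive[of m] p.S_negative[of m] q.S_negative[of m] assms(3,4) that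
    by auto
  have inv: "1 / S m > 1 / S' m \<longleftrightarrow> S m < S' m" if "m + 4 \<le> D" for m
    using sign[OF that] by (auto simp: field_simps mult_neg_neg)
  show ?case
  proof (cases n)
    case 0
    then show ?thesis using assms(3) by simp
  next
    case (Suc m)
    have pos: "0 < b 2" "0 < b 3" "0 < b (n + 2)" "0 < b (n + 3)" "0 \<le> c n" "0 \<le> c (n - 1)"
      using p.b_pos p.c_pos[of m] p.c_pos[of "m - 1"] p.c_0 less.prems Suc by (auto, cases m, auto)
    have "1 / S' 0 < 1 / S 0" using inv[of 0] assms(3) less.prems by simp
    then have "b 2 * b 3 * (1 / S' 0) < b 2 * b 3 * (1 / S 0)"
      using pos by (intro mult_strict_left_mono) auto
    then have psi: "p.psi < q.psi" by (simp add: p.psi_def q.psi_def)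
    have "c n * c (n - 1) * S (n - 2) \<le> c n * c (n - 1) * S' (n - 2)" if "2 \<le> n"
      using less.IH[of "n - 2"] less.prems that pos by (intro mult_left_mono) auto
    then have "b (n + 2) * b (n + 3) / S n > b (n + 2) * b (n + 3) / S' n"
      using p.riccati[of n] q.riccati[of n] sign[of 0] less.prems psi by auto
    then have "b (n + 2) * b (n + 3) * (1 / S' n) < b (n + 2) * b (n + 3) * (1 / S n)" by simp
    then have "1 / S' n < 1 / S n" using pos by (metis mult_less_cancel_left_pos mult_pos_pos)
    then show ?thesis using inv less.prems by blast
  qed
qed

text \<open>On one side of 0 this is monotonicity. Otherwise \<open>S 0\<close> and
  \<open>S' 0\<close> differ in sign, with 0 as a sign of its own, and these signs persist to
  \<open>S n\<close> and \<open>S' n\<close>.\<close>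

lemma norm_recurrence_inj:
  assumes "norm_recurrence b c D S N e" and "norm_recurrence b c D S' N' e'"
    and "n + 4 \<le> D" and "S n = S' n"
  shows "S 0 = S' 0"
proof (rule ccontr)
  assume ne: "S 0 \<noteq> S' 0"
  interpret p: norm_recurrence b c D S N e by fact
  interpret q: norm_recurrence b c D S' N' e' by fact
  note sign = p.S_positive[of n] q.S_positive[of n] p.S_negative[of n] q.S_negative[of n]
    p.S_zero[of n] q.S_zero[of n] assms(3,4)
  consider "S 0 < S' 0" "0 < S 0 \<or> S' 0 < 0" | "S' 0 < S 0" "0 < S' 0 \<or> S 0 < 0"
    | "S 0 \<le> 0" "0 \<le> S' 0" | "S' 0 \<le> 0" "0 \<le> S 0"
    using ne by linarith
  then show False
  proof cases
    case 1
    then show False using norm_recurrence_mono[OF assms(1,2) 1 assms(3)] assms(4) by simp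
  next
    case 2
    then show False using norm_recurrence_mono[OF assms(2,1) 2 assms(3)] assms(4) by simp
  next
    case 3
    then show False using sign ne by (cases "S 0 = 0"; cases "S' 0 = 0") auto
  next
    case 4
    then show False using sign ne by (cases "S 0 = 0"; cases "S' 0 = 0") auto
  qed
qed

section \<open>Modules of the Terwilliger algebra\<close>

lemma scaled_matrix_mult: "(\<chi> u v. a * B $ u $ v) *v w = a *s (B *v w)" for a :: complex
  by (simp add: matrix_vector_mult_def vec_eq_iff sum_distrib_left mult.assoc)

lemma terwilliger_algebra_induct [consumes 1, case_names adj idem one add mult scale]:
  assumes "B \<in> terwilliger_algebra adj x"
    and "P (adj_matrix adj)" and "\<And>i. i \<le> diam adj \<Longrightarrow> P (dual_idem adj x i)" and "P (mat 1)"
    and "\<And>A B. P A \<Longrightarrow> P B \<Longrightarrow> P (A + B)" and "\<And>A B. P A \<Longrightarrow> P B \<Longrightarrow> P (A ** B)"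
    and "\<And>a B. P B \<Longrightarrow> P (\<chi> u v. a * B $ u $ v)"
  shows "P B"
proof -
  have "terwilliger_algebra adj x \<subseteq> {B. P B}"
    unfolding terwilliger_algebra_def
    by (rule hull_minimal) (use assms in \<open>auto simp: matrix_subalgebra_def\<close>)
  then show ?thesis using assms(1) by auto
qed

lemma adj_matrix_in_algebra: "adj_matrix adj \<in> terwilliger_algebra adj x"
  and dual_idem_in_algebra: "i \<le> diam adj \<Longrightarrow> dual_idem adj x i \<in> terwilliger_algebra adj x"
  unfolding terwilliger_algebra_def by (rule hull_inc; simp)+

lemma T_moduleI:
  assumes W: "vec.subspace W" and "\<And>w. w \<in> W \<Longrightarrow> adj_matrix adj *v w \<in> W"
    and "\<And>i w. i \<le> diam adj \<Longrightarrow> w \<in> W \<Longrightarrow> dual_idem adj x i *v w \<in> W"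
  shows "T_module adj x W"
  unfolding T_module_def
proof (intro conjI ballI)
  fix B w assume "B \<in> terwilliger_algebra adj x" "w \<in> W"
  from this show "B *v w \<in> W"
    by (induction arbitrary: w rule: terwilliger_algebra_induct)
      (auto simp: assms scaled_matrix_mult matrix_vector_mult_add_rdistrib vec.subspace_add
        vec.subspace_scale simp flip: matrix_vector_mul_assoc)
qed (rule W)

lemma T_isomorphicI:
  assumes W: "T_module adj x W"
    and add: "\<And>u w. \<sigma> (u + w) = \<sigma> u + \<sigma> w" and scale: "\<And>a w. \<sigma> (a *s w) = a *s \<sigma> w"
    and inv: "\<And>w. w \<in> W \<Longrightarrow> \<sigma> w \<in> W' \<and> \<tau> (\<sigma> w) = w" "\<And>w. w \<in> W' \<Longrightarrow> \<tau> w \<in> W \<and> \<sigma> (\<tau> w) = w"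
    and A: "\<And>w. w \<in> W \<Longrightarrow> \<sigma> (adj_matrix adj *v w) = adj_matrix adj *v \<sigma> w"
    and E: "\<And>i w. i \<le> diam adj \<Longrightarrow> w \<in> W \<Longrightarrow> \<sigma> (dual_idem adj x i *v w) = dual_idem adj x i *v \<sigma> w"
  shows "T_isomorphic adj x W W'"
  unfolding T_isomorphic_def
proof (intro exI[of _ \<sigma>] conjI ballI allI)
  show "bij_betw \<sigma> W W'" by (rule bij_betw_byWitness[where f' = \<tau>]) (use inv in auto)
next
  show "\<sigma> (u + w) = \<sigma> u + \<sigma> w" for u w by (rule add)
next
  show "\<sigma> (a *s w) = a *s \<sigma> w" for a w by (rule scale)
next
  fix B w assume B: "B \<in> terwilliger_algebra adj x" and w: "w \<in> W"
  have mem: "w \<in> W \<Longrightarrow> B *v w \<in> W" if "B \<in> terwilliger_algebra adj x" for B w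
    using W that by (simp add: T_module_def)
  have sub: "vec.subspace W" using W by (simp add: T_module_def)
  \<comment> \<open>Invariance of \<open>W\<close> is part of the induction claim: for a product,
    the hypothesis on the left factor is applied to the image under the right one.\<close>
  from B have "\<forall>w\<in>W. B *v w \<in> W \<and> \<sigma> (B *v w) = B *v \<sigma> w"
    by (induction rule: terwilliger_algebra_induct)
      (auto simp: A E mem adj_matrix_in_algebra dual_idem_in_algebra scaled_matrix_mult
        matrix_vector_mult_add_rdistrib vec.subspace_add[OF sub] vec.subspace_scale[OF sub]
        add scale simp flip: matrix_vector_mul_assoc)
  then show "\<sigma> (B *v w) = B *v \<sigma> w" using w by blast
qed

lemma vec_dim_le_1_multiple:
  fixes S :: "(complex^'n::finite) set"
  assumes "vec.dim S \<le> 1" "u \<in> S" "w \<in> S" "u \<noteq> 0"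
  shows "\<exists>a. w = a *s u"
proof (rule ccontr)
  assume no: "\<nexists>a. w = a *s u"
  then have "w \<noteq> u" by (metis vec.scale_one)
  have "vec.independent {w, u}"
    using no assms(4) by (simp add: vec.independent_insert vec.span_singleton \<open>w \<noteq> u\<close> image_iff)
  then have "card {w, u} \<le> vec.dim S" using assms by (intro vec.independent_card_le_dim) auto
  then show False using assms(1) \<open>w \<noteq> u\<close> by simp
qed

lemma span_linear_mem:
  fixes S :: "(complex^'n::finite) set"
  assumes "w \<in> vec.span S" and U: "vec.subspace U"
    and add: "\<And>u w. f (u + w) = f u + f w" and scale: "\<And>a w. f (a *s w) = a *s f w"
    and "\<And>v. v \<in> S \<Longrightarrow> f v \<in> U"
  shows "f w \<in> U"
  using assms(1)
proof (induction rule: vec.span_induct)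
  case base
  have "f 0 = 0" using scale[of 0 0] by simp
  then show ?case
    using U by (auto simp: vec.subspace_def add scale)
qed (use assms(5) in auto)

section \<open>Distance matrices acting on a vector\<close>

context bipartite_drg
begin

lemma adj_matrix_mult: "(adj_matrix adj *v v) $ z = (\<Sum>u\<in>{u. adj z u}. v $ u)"
  by (simp add: adj_matrix_def matrix_vector_mult_def if_distrib[of "\<lambda>a. a * _"] sum.If_cases
      cong: if_cong)

lemma dual_idem_mult: "(dual_idem adj x i *v v) $ z = (if d x z = i then v $ z else 0)"
proof -
  have "(dual_idem adj x i *v v) $ z = (\<Sum>u\<in>UNIV. if z = u then (if d x z = i then v $ u else 0) else 0)"
    unfolding dual_idem_def matrix_vector_mult_def vec_lambda_beta
    by (rule sum.cong) auto
  then show ?thesis by (simp only: sum.delta[OF finite] UNIV_I if_True sum.delta'[OF finite])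
qed

text \<open>This is \<open>A\<^sub>j v\<close> for the distance-\<open>j\<close> matrix
  \<open>A\<^sub>j\<close>.\<close>

definition dist_vec :: "complex^'a \<Rightarrow> nat \<Rightarrow> complex^'a" where
  "dist_vec v j = (\<chi> z. \<Sum>y\<in>{y. d y z = j}. v $ y)"

definition dist_part :: "'a \<Rightarrow> complex^'a \<Rightarrow> nat \<Rightarrow> nat \<Rightarrow> complex^'a" where
  "dist_part x v i j = (\<chi> z. if d x z = i then dist_vec v j $ z else 0)"

lemma dist_part_eq: "dist_part x v i j = dual_idem adj x i *v dist_vec v j"
  by (simp add: vec_eq_iff dual_idem_mult dist_part_def)

lemma dist_vec_nth: "dist_vec v j $ z = (\<Sum>y\<in>UNIV. (if d y z = j then 1 else 0) * v $ y)"
  by (simp add: dist_vec_def sum.If_cases if_distrib[of "\<lambda>a. a * _"] cong: if_cong)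

text \<open>Reduces the action of \<open>A\<close> to counting neighbours of \<open>z\<close> with
  prescribed distances to \<open>x\<close> and \<open>y\<close>.\<close>

lemma adj_dist_part:
  "(adj_matrix adj *v dist_part x v i j) $ z
    = (\<Sum>y\<in>UNIV. of_nat (card {u. adj z u \<and> d x u = i \<and> d y u = j}) * v $ y)"
proof -
  have "(adj_matrix adj *v dist_part x v i j) $ z
      = (\<Sum>u\<in>{u. adj z u}. \<Sum>y\<in>UNIV. if d x u = i \<and> d y u = j then v $ y else 0)"
    unfolding adj_matrix_mult dist_part_def dist_vec_nth by (auto intro!: sum.cong)
  also have "\<dots> = (\<Sum>y\<in>UNIV. \<Sum>u\<in>{u. adj z u}. if d x u = i \<and> d y u = j then v $ y else 0)"
    by (rule sum.swap)
  also have "\<dots> = (\<Sum>y\<in>UNIV. of_nat (card {u. adj z u \<and> d x u = i \<and> d y u = j}) * v $ y)"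
    by (simp add: sum.If_cases Int_def)
  finally show ?thesis .
qed

lemma card_adj_dist:
  "int (card {u. adj z u \<and> d y u = j})
    = (if d y z = Suc j then c (Suc j) else if Suc (d y z) = j then b (j - 1) else 0)"
proof -
  consider "d y z = Suc j" | "Suc (d y z) = j" | "d y z \<noteq> Suc j" "Suc (d y z) \<noteq> j" by blast
  then show ?thesis
  proof cases
    case 1
    then show ?thesis using card_c by simp
  next
    case 2
    then obtain l where "j = Suc l" "d y z = l" by auto
    then show ?thesis using card_b[of y z l] by simp
  next
    case 3
    have "\<not> (adj z u \<and> d y u = j)" for u using 3 adj_gdist[of z u y] by linarith
    then have empty: "{u. adj z u \<and> d y u = j} = {}" by blast
    show ?thesis unfolding empty using 3 by simp
  qed
qed

text \<open>The three-term recurrence of the distance matrices; its middle term is absent because in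
  a bipartite graph no step preserves the distance.\<close>

lemma adj_dist_vec:
  "adj_matrix adj *v dist_vec v (Suc j)
    = of_int (c (j + 2)) *s dist_vec v (j + 2) + of_int (b j) *s dist_vec v j"
proof (rule vec_eq_iff[THEN iffD2], rule allI)
  fix z
  have "(adj_matrix adj *v dist_vec v (Suc j)) $ z
      = (\<Sum>u\<in>{u. adj z u}. \<Sum>y\<in>UNIV. if d y u = Suc j then v $ y else 0)"
    unfolding adj_matrix_mult dist_vec_nth by (auto intro!: sum.cong)
  also have "\<dots> = (\<Sum>y\<in>UNIV. \<Sum>u\<in>{u. adj z u}. if d y u = Suc j then v $ y else 0)"
    by (rule sum.swap)
  also have "\<dots> = (\<Sum>y\<in>UNIV. of_int (int (card {u. adj z u \<and> d y u = Suc j})) * v $ y)"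
    by (simp add: sum.If_cases Int_def)
  also have "\<dots> = (\<Sum>y\<in>UNIV. of_int (c (j + 2)) * ((if d y z = j + 2 then 1 else 0) * v $ y)
      + of_int (b j) * ((if d y z = j then 1 else 0) * v $ y))"
    by (intro sum.cong) (auto simp: card_adj_dist)
  finally show "(adj_matrix adj *v dist_vec v (Suc j)) $ z
    = (of_int (c (j + 2)) *s dist_vec v (j + 2) + of_int (b j) *s dist_vec v j) $ z"
    by (simp only: sum.distrib sum_distrib_left[symmetric] dist_vec_nth vector_add_component
        vector_smult_component)
qed

lemma dist_vec_0: "dist_vec v 0 = v"
  by (simp add: dist_vec_def vec_eq_iff)

lemma dist_vec_1: "dist_vec v (Suc 0) = adj_matrix adj *v v"
proof -
  have "{y. d y z = Suc 0} = {u. adj z u}" for z using adj_iff_gdist gdist_sym by auto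
  then show ?thesis by (simp add: vec_eq_iff adj_matrix_mult dist_vec_def)
qed

lemma dist_vec_beyond: "D < j \<Longrightarrow> dist_vec v j = 0"
proof -
  assume "D < j"
  then have "{y. d y z = j} = {}" for z using gdist_le_diam by (metis (mono_tags, lifting) empty_Collect_eq leD)
  then show ?thesis by (simp add: dist_vec_def vec_eq_iff)
qed

text \<open>Each \<open>A\<^sub>j\<close> is a polynomial in \<open>A\<close>: up to the diameter
  \<open>c (j + 2)\<close> is nonzero, so the three-term recurrence can be solved for its leading
  term.\<close>

lemma dist_vec_mem:
  assumes W: "T_module adj x W" and v: "v \<in> W"
  shows "dist_vec v j \<in> W"
proof -
  have sub: "vec.subspace W" and A: "\<And>w. w \<in> W \<Longrightarrow> adj_matrix adj *v w \<in> W"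
    using W adj_matrix_in_algebra by (auto simp: T_module_def)
  have "dist_vec v j \<in> W \<and> dist_vec v (Suc j) \<in> W"
  proof (induction j)
    case 0
    then show ?case using v A by (simp add: dist_vec_0 dist_vec_1)
  next
    case (Suc j)
    show ?case
    proof (cases "j + 2 \<le> D")
      case True
      then have "of_int (c (j + 2)) \<noteq> (0::complex)" using c_pos[of "Suc j"] by simp
      then have "dist_vec v (j + 2) = (1 / of_int (c (j + 2))) *s
          (adj_matrix adj *v dist_vec v (Suc j) - of_int (b j) *s dist_vec v j)"
        by (simp add: adj_dist_vec vec_eq_iff)
      also have "\<dots> \<in> W" using Suc A by (intro vec.subspace_scale[OF sub] vec.subspace_diff[OF sub]) auto
      finally show ?thesis using Suc by simp
    next
      case False
      then show ?thesis using Suc dist_vec_beyond[of "j + 2" v] vec.subspace_0[OF sub] by simp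
    qed
  qed
  then show ?thesis by blast
qed

end

section \<open>Vectors generating modules with endpoint two\<close>

text \<open>\<open>balanced\<close> says \<open>E\<^sup>*\<^sub>1 A v = 0\<close>, which together with \<open>support\<close> makes \<open>v\<close> orthogonal to all irreducible
  modules with endpoint less than 2.\<close>

locale endpoint_two_vector = bipartite_drg +
  fixes x :: 'a and v :: "complex^'a"
  assumes support: "\<And>y. d x y \<noteq> 2 \<Longrightarrow> v $ y = 0"
    and balanced: "\<And>w. adj x w \<Longrightarrow> (\<Sum>y\<in>{y. adj w y}. v $ y) = 0"
    and diam: "4 \<le> D"
begin

abbreviation A :: "complex^'a^'a" where "A \<equiv> adj_matrix adj"
abbreviation E :: "nat \<Rightarrow> complex^'a^'a" where "E \<equiv> dual_idem adj x"
abbreviation part :: "nat \<Rightarrow> nat \<Rightarrow> complex^'a" where "part \<equiv> dist_part x v"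

text \<open>\<open>part i j\<close> is \<open>E\<^sup>*\<^sub>i A\<^sub>j v\<close>.\<close>

definition chain :: "nat \<Rightarrow> complex^'a" where "chain n = part (n + 2) n"

lemma part_nth: "part i j $ z = (\<Sum>y\<in>UNIV. (if d x z = i \<and> d y z = j then 1 else 0) * v $ y)"
  by (auto simp: dist_part_def dist_vec_nth)

lemma part_outside: "d x z \<noteq> i \<Longrightarrow> part i j $ z = 0"
  by (simp add: dist_part_def)

lemma chain_outside: "d x z \<noteq> n + 2 \<Longrightarrow> chain n $ z = 0"
  by (simp add: chain_def part_outside)

lemma adj_outside: 
  assumes "\<And>z. d x z \<noteq> i \<Longrightarrow> f $ z = 0" "i \<noteq> Suc (d x z)" "d x z \<noteq> Suc i"
  shows "(A *v f) $ z = 0"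
proof -
  have "f $ u = 0" if "adj z u" for u
    using adj_gdist[OF that, of x] assms by metis
  then show ?thesis by (auto simp: adj_matrix_mult intro!: sum.neutral)
qed

lemma sum_weighted_cong:
  assumes "\<And>y. d x y = 2 \<Longrightarrow> f y = (g y :: complex)"
  shows "(\<Sum>y\<in>UNIV. f y * v $ y) = (\<Sum>y\<in>UNIV. g y * v $ y)"
proof (rule sum.cong[OF refl])
  show "f y * v $ y = g y * v $ y" for y using assms[of y] support[of y] by (cases "d x y = 2") auto
qed

text \<open>Adding the balance conditions over all neighbours \<open>w\<close> of \<open>x\<close>
  counts every \<open>y\<close> of the support \<open>c 2\<close> times.\<close>

lemma sum_v: "(\<Sum>y\<in>UNIV. v $ y) = 0"
proof -
  have "0 = (\<Sum>w\<in>{w. adj x w}. \<Sum>y\<in>{y. adj w y}. v $ y)" using balanced by simp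
  also have "\<dots> = (\<Sum>w\<in>{w. adj x w}. \<Sum>y\<in>UNIV. if adj w y then v $ y else 0)"
    by (simp add: sum.If_cases)
  also have "\<dots> = (\<Sum>y\<in>UNIV. \<Sum>w\<in>{w. adj x w}. if adj w y then v $ y else 0)"
    by (rule sum.swap)
  also have "\<dots> = (\<Sum>y\<in>UNIV. of_int (int (card {w. adj x w \<and> adj y w})) * v $ y)"
    by (simp add: sum.If_cases Int_def adj_sym)
  also have "\<dots> = (\<Sum>y\<in>UNIV. of_int (c 2) * v $ y)"
    by (rule sum_weighted_cong) (simp only: card_common)
  finally have "of_int (c 2) * (\<Sum>y\<in>UNIV. v $ y) = 0" by (simp add: sum_distrib_left)
  then show ?thesis using c_pos[of 1] diam by (simp add: numeral_2_eq_2)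
qed

text \<open>Parity and the triangle inequality leave only these three distances to points of the
  support, so each entry is the total sum of \<open>v\<close>, which is 0.\<close>

lemma part_sum: "part (n + 2) n + part (n + 2) (n + 2) + part (n + 2) (n + 4) = 0"
proof (rule vec_eq_iff[THEN iffD2], rule allI)
  fix z
  show "(part (n + 2) n + part (n + 2) (n + 2) + part (n + 2) (n + 4)) $ z = 0 $ z"
  proof (cases "d x z = n + 2")
    case True
    have "(part (n + 2) n + part (n + 2) (n + 2) + part (n + 2) (n + 4)) $ z
      = (\<Sum>y\<in>UNIV. ((if d y z = n then 1 else 0) + (if d y z = n + 2 then 1 else 0)
          + (if d y z = n + 4 then 1 else 0)) * v $ y)"
      using True by (simp only: vector_add_component part_nth sum.distrib distrib_right simp_thms)
    also have "\<dots> = (\<Sum>y\<in>UNIV. 1 * v $ y)"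
    proof (rule sum_weighted_cong)
      fix y assume y: "d x y = 2"
      have "even (d y z + n)" using even_gdist_add[of x y z] y True by simp
      then have "d y z \<noteq> n + 1" "d y z \<noteq> n + 3" by auto
      then have "d y z = n \<or> d y z = n + 2 \<or> d y z = n + 4"
        using gdist_triangle[of x z y] gdist_triangle[of y z x] y True gdist_sym[of y x] by linarith
      then show "((if d y z = n then 1 else 0) + (if d y z = n + 2 then 1 else 0)
          + (if d y z = n + 4 then 1 else 0)) = (1::complex)" by auto
    qed
    finally show ?thesis using sum_v by simp
  qed (simp add: part_outside)
qed

text \<open>Only \<open>y\<close> with \<open>d y z = n + 1\<close> contribute, and for these the
  triangle inequality puts every neighbour \<open>u\<close> of \<open>z\<close> with
  \<open>d y u = n\<close> on level \<open>n + 2\<close>, so the count is \<open>c (n + 1)\<close>.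
  \<open>adj_far_down\<close> is the mirror image.\<close>

lemma adj_chain_up:
  assumes "d x z = n + 3"
  shows "(A *v chain n) $ z = of_int (c (n + 1)) * chain (n + 1) $ z"
proof -
  have "(A *v chain n) $ z
      = (\<Sum>y\<in>UNIV. (of_int (c (n + 1)) * (if d x z = n + 1 + 2 \<and> d y z = n + 1 then 1 else 0)) * v $ y)"
    unfolding chain_def adj_dist_part
  proof (rule sum_weighted_cong)
    fix y assume y: "d x y = 2"
    show "of_nat (card {u. adj z u \<and> d x u = n + 2 \<and> d y u = n})
      = of_int (c (n + 1)) * (if d x z = n + 1 + 2 \<and> d y z = n + 1 then 1 else (0::complex))"
    proof (cases "d y z = n + 1")
      case True
      have "d x u = n + 2" if "adj z u" "d y u = n" for u
        using adj_gdist[OF that(1), of x] gdist_triangle[of x u y] y assms that(2) by linarith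
      then have eq: "{u. adj z u \<and> d x u = n + 2 \<and> d y u = n} = {u. adj z u \<and> d y u = n}" by blast
      have "int (card {u. adj z u \<and> d y u = n}) = c (n + 1)" using card_c[of y z n] True by simp
      then have "of_nat (card {u. adj z u \<and> d y u = n}) = (of_int (c (n + 1)) :: complex)"
        by (metis of_int_of_nat_eq)
      then show ?thesis using True assms eq by simp
    next
      case False
      have "\<not> (adj z u \<and> d x u = n + 2 \<and> d y u = n)" for u
        using adj_gdist[of z u y] gdist_triangle[of x z y] y assms False by linarith
      then have "{u. adj z u \<and> d x u = n + 2 \<and> d y u = n} = {}" by blast
      then have "card {u. adj z u \<and> d x u = n + 2 \<and> d y u = n} = 0" by simp
      then show ?thesis using False by simp
    qed
  qed
  then show ?thesis by (simp add: chain_def part_nth sum_distrib_left mult.assoc)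
qed

lemma adj_far_down:
  assumes "d x z = n + 2"
  shows "(A *v part (n + 3) (n + 5)) $ z = of_int (b (n + 4)) * part (n + 2) (n + 4) $ z"
proof -
  have "(A *v part (n + 3) (n + 5)) $ z
      = (\<Sum>y\<in>UNIV. (of_int (b (n + 4)) * (if d x z = n + 2 \<and> d y z = n + 4 then 1 else 0)) * v $ y)"
    unfolding adj_dist_part
  proof (rule sum_weighted_cong)
    fix y assume y: "d x y = 2"
    show "of_nat (card {u. adj z u \<and> d x u = n + 3 \<and> d y u = n + 5})
      = of_int (b (n + 4)) * (if d x z = n + 2 \<and> d y z = n + 4 then 1 else (0::complex))"
    proof (cases "d y z = n + 4")
      case True
      have "d x u = n + 3" if "adj z u" "d y u = n + 5" for u
        using adj_gdist[OF that(1), of x] gdist_triangle[of y u x] y assms that(2) gdist_sym[of y x]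
        by linarith
      then have eq: "{u. adj z u \<and> d x u = n + 3 \<and> d y u = n + 5} = {u. adj z u \<and> d y u = n + 5}" by blast
      have "int (card {u. adj z u \<and> d y u = n + 5}) = b (n + 4)"
        using card_b[of y z "n + 4"] True by (simp add: eval_nat_numeral)
      then have "of_nat (card {u. adj z u \<and> d y u = n + 5}) = (of_int (b (n + 4)) :: complex)"
        by (metis of_int_of_nat_eq)
      then show ?thesis using True assms eq by simp
    next
      case False
      have "\<not> (adj z u \<and> d x u = n + 3 \<and> d y u = n + 5)" for u
        using adj_gdist[of z u y] gdist_triangle[of y z x] y assms False gdist_sym[of y x] by linarith
      then have "{u. adj z u \<and> d x u = n + 3 \<and> d y u = n + 5} = {}" by blast
      then have "card {u. adj z u \<and> d x u = n + 3 \<and> d y u = n + 5} = 0" by simp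
      then show ?thesis using False by simp
    qed
  qed
  then show ?thesis by (simp add: part_nth sum_distrib_left mult.assoc)
qed

text \<open>The neighbours of \<open>z\<close> lie on levels \<open>m\<close> and
  \<open>m + 2\<close>; adding both parts lifts the restriction on the level and leaves the count of
  \<open>card_adj_dist\<close>.\<close>

lemma adj_part_sum:
  assumes z: "d x z = m + 1"
  shows "(A *v part (m + 2) (j + 1)) $ z + (A *v part m (j + 1)) $ z
    = of_int (b j) * part (m + 1) j $ z + of_int (c (j + 2)) * part (m + 1) (j + 2) $ z"
proof -
  have card: "of_nat (card {u. adj z u \<and> d x u = m + 2 \<and> d y u = j + 1})
        + of_nat (card {u. adj z u \<and> d x u = m \<and> d y u = j + 1})
      = of_int (b j) * (if d x z = m + 1 \<and> d y z = j then 1 else 0)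
        + of_int (c (j + 2)) * (if d x z = m + 1 \<and> d y z = j + 2 then 1 else (0 :: complex))" for y
  proof -
    have "d x u = m + 2 \<or> d x u = m" if "adj z u" for u
      using adj_gdist[OF that, of x] z by linarith
    then have "{u. adj z u \<and> d y u = j + 1} = {u. adj z u \<and> d x u = m + 2 \<and> d y u = j + 1}
        \<union> {u. adj z u \<and> d x u = m \<and> d y u = j + 1}" (is "?U = ?V \<union> ?W") by blast
    moreover have "card (?V \<union> ?W) = card ?V + card ?W" by (rule card_Un_disjoint) auto
    ultimately have "int (card ?V) + int (card ?W) = int (card ?U)" by simp
    also have "\<dots> = b j * (if d y z = j then 1 else 0) + c (j + 2) * (if d y z = j + 2 then 1 else 0)"
      by (simp add: card_adj_dist)
    finally have "of_int (int (card ?V) + int (card ?W))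
        = (of_int (b j * (if d y z = j then 1 else 0) + c (j + 2) * (if d y z = j + 2 then 1 else 0)) :: complex)"
      by simp
    then show ?thesis using z by simp
  qed
  have "(A *v part (m + 2) (j + 1)) $ z + (A *v part m (j + 1)) $ z
      = (\<Sum>y\<in>UNIV. (of_nat (card {u. adj z u \<and> d x u = m + 2 \<and> d y u = j + 1})
        + of_nat (card {u. adj z u \<and> d x u = m \<and> d y u = j + 1})) * v $ y)"
    by (simp only: adj_dist_part sum.distrib distrib_right)
  then show ?thesis
    unfolding card by (simp only: part_nth sum.distrib distrib_right sum_distrib_left mult.assoc)
qed

lemma chain_0: "chain 0 = v"
  using support by (auto simp: chain_def dist_part_def dist_vec_0 vec_eq_iff)

lemma part_1_1: "part 1 1 = 0"
proof -
  have "{y. d y z = 1} = {y. adj z y}" for z using adj_iff_gdist gdist_sym by auto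
  then have "dist_vec v 1 $ z = (\<Sum>y\<in>{y. adj z y}. v $ y)" for z by (simp add: dist_vec_def)
  then show ?thesis using balanced by (auto simp: dist_part_def vec_eq_iff adj_iff_gdist)
qed

lemma adj_chain_0_down: "d x z = 1 \<Longrightarrow> (A *v chain 0) $ z = 0"
  using balanced[of z] by (simp add: chain_0 adj_matrix_mult adj_iff_gdist)

lemma chain_beyond: "D < n + 2 \<Longrightarrow> chain n = 0"
  by (metis chain_outside gdist_le_diam leD vec_eq_iff zero_index)

lemma E_mult: "(E i *v f) $ z = (if d x z = i then f $ z else 0)"
  by (rule dual_idem_mult)

lemma E_adj_chain: "E (n + 3) *v (A *v chain n) = of_int (c (n + 1)) *s chain (n + 1)"
  by (auto simp: vec_eq_iff E_mult adj_chain_up chain_outside)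

lemma chain_Suc_zero: "chain n = 0 \<Longrightarrow> chain (n + 1) = 0"
proof (cases "n + 3 \<le> D")
  case True
  assume "chain n = 0"
  then have "of_int (c (n + 1)) *s chain (n + 1) = 0" using E_adj_chain[of n] by simp
  moreover have "of_int (c (n + 1)) \<noteq> (0::complex)" using c_pos[of n] True by simp
  ultimately show ?thesis by (simp add: vec_eq_iff)
qed (simp add: chain_beyond)

lemma E_chain: "E i *v chain n = (if i = n + 2 then chain n else 0)"
  by (auto simp: vec_eq_iff E_mult chain_outside)

lemma E_far_down: "E (n + 2) *v (A *v part (n + 3) (n + 5)) = of_int (b (n + 4)) *s part (n + 2) (n + 4)"
  by (auto simp: vec_eq_iff E_mult adj_far_down part_outside)

lemma E_adj_chain_1:
  "E 2 *v (A *v chain 1) = of_int (b 0) *s chain 0 + of_int (c 2) *s part 2 2"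
proof -
  have "(A *v part 3 1) $ z = of_int (b 0) * part 2 0 $ z + of_int (c 2) * part 2 2 $ z" if "d x z = 2" for z
  proof -
    have "(A *v part 1 1) $ z = 0" unfolding part_1_1 by simp
    then show ?thesis using adj_part_sum[of z 1 0] that by (simp add: numeral_3_eq_3 numeral_2_eq_2)
  qed
  then show ?thesis
    by (auto simp: vec_eq_iff E_mult chain_def part_outside numeral_3_eq_3 numeral_2_eq_2)
qed

lemma E_adj_chain_down:
  "E (n + 3) *v (A *v chain (n + 2)) + E (n + 3) *v (A *v part (n + 2) (n + 2))
    = of_int (b (n + 1)) *s chain (n + 1) + of_int (c (n + 3)) *s part (n + 3) (n + 3)"
proof -
  have "(A *v chain (n + 2)) $ z + (A *v part (n + 2) (n + 2)) $ z
    = of_int (b (n + 1)) * chain (n + 1) $ z + of_int (c (n + 3)) * part (n + 3) (n + 3) $ z"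
    if "d x z = n + 3" for z
    using adj_part_sum[of z "n + 2" "n + 1"] that by (simp add: chain_def add.assoc eval_nat_numeral)
  then show ?thesis
    by (auto simp: vec_eq_iff E_mult chain_outside part_outside)
qed

section \<open>Norms along the chain\<close>

definition chain_norm :: "nat \<Rightarrow> real" where
  "chain_norm n = (\<Sum>z\<in>UNIV. (cmod (chain n $ z))\<^sup>2)"

lemma chain_norm_nonneg: "0 \<le> chain_norm n"
  unfolding chain_norm_def by (intro sum_nonneg) auto

lemma chain_norm_0_iff: "chain_norm n = 0 \<longleftrightarrow> chain n = 0"
  by (auto simp: chain_norm_def sum_nonneg_eq_0_iff vec_eq_iff)

lemma adj_self_adjoint: "(\<Sum>z\<in>UNIV. (A *v f) $ z * cnj (g $ z)) = (\<Sum>u\<in>UNIV. f $ u * cnj ((A *v g) $ u))"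
proof -
  have "(\<Sum>z\<in>UNIV. (A *v f) $ z * cnj (g $ z)) = (\<Sum>z\<in>UNIV. \<Sum>u\<in>UNIV. if adj z u then f $ u * cnj (g $ z) else 0)"
    by (simp add: adj_matrix_mult sum_distrib_right sum.If_cases)
  also have "\<dots> = (\<Sum>u\<in>UNIV. \<Sum>z\<in>UNIV. if adj u z then f $ u * cnj (g $ z) else 0)"
    by (subst sum.swap) (simp add: adj_sym)
  also have "\<dots> = (\<Sum>u\<in>UNIV. f $ u * cnj ((A *v g) $ u))"
    by (simp add: adj_matrix_mult sum_distrib_left sum.If_cases)
  finally show ?thesis .
qed

text \<open>Pairing \<open>A *v chain (n + 1)\<close> with \<open>chain n\<close>, the self-adjoint
  \<open>A\<close> is moved to the other side, where only level \<open>n + 3\<close> matters. In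
  particular \<open>e\<close> is real when \<open>chain n\<close> is nonzero.\<close>

lemma chain_norm_rec:
  assumes "E (n + 2) *v (A *v chain (n + 1)) = e *s chain n"
  shows "e * of_real (chain_norm n) = of_int (c (n + 1)) * of_real (chain_norm (n + 1))"
proof -
  have "e * of_real (chain_norm n) = (\<Sum>z\<in>UNIV. (e *s chain n) $ z * cnj (chain n $ z))"
    by (simp add: chain_norm_def sum_distrib_left mult.assoc complex_norm_square del: of_real_power)
  also have "\<dots> = (\<Sum>z\<in>UNIV. (A *v chain (n + 1)) $ z * cnj (chain n $ z))"
    unfolding assms[symmetric] by (intro sum.cong) (auto simp: E_mult chain_outside)
  also have "\<dots> = (\<Sum>u\<in>UNIV. chain (n + 1) $ u * cnj ((A *v chain n) $ u))"
    by (rule adj_self_adjoint)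
  also have "\<dots> = (\<Sum>u\<in>UNIV. chain (n + 1) $ u * cnj (of_int (c (n + 1)) * chain (n + 1) $ u))"
  proof (intro sum.cong refl)
    fix u
    show "chain (n + 1) $ u * cnj ((A *v chain n) $ u)
        = chain (n + 1) $ u * cnj (of_int (c (n + 1)) * chain (n + 1) $ u)"
    proof (cases "d x u = n + 3")
      case True
      then show ?thesis by (simp only: adj_chain_up)
    next
      case False
      then have "chain (n + 1) $ u = 0" by (intro chain_outside) auto
      then show ?thesis by simp
    qed
  qed
  also have "\<dots> = of_int (c (n + 1)) * of_real (chain_norm (n + 1))"
    by (simp add: chain_norm_def sum_distrib_left complex_norm_square mult.left_commute del: of_real_power)
  finally show ?thesis .
qed

lemma adj_chain_split: 
  "A *v chain n = E (n + 3) *v (A *v chain n) + E (n + 1) *v (A *v chain n)"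
proof -
  have "(A *v chain n) $ z = 0" if "d x z \<noteq> n + 3" "d x z \<noteq> n + 1" for z
    using that by (intro adj_outside[of "n + 2"] chain_outside) auto
  then show ?thesis by (auto simp: vec_eq_iff E_mult)
qed

end

section \<open>Thin modules with endpoint two\<close>

text \<open>\<open>chain_down\<close> is what thinness provides: with \<open>E_adj_chain\<close> it
  makes \<open>A\<close> act on the chain by a tridiagonal matrix with zero diagonal.\<close>

locale thin_vector = endpoint_two_vector adj x v for adj :: "'a::finite \<Rightarrow> 'a \<Rightarrow> bool" and x v +
  fixes W :: "(complex^'a) set"
  assumes v_nonzero: "v \<noteq> 0"
    and module: "T_module adj x W"
    and W_eq: "W = vec.span (range chain)"
    and chain_down: "\<And>n. \<exists>e. E (n + 2) *v (A *v chain (n + 1)) = e *s chain n"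

text \<open>Any nonzero \<open>v\<close> in \<open>E\<^sup>*\<^sub>2 W\<close> serves: endpoint 2
  makes it balanced, and its chain spans a nonzero submodule, which is \<open>W\<close> by
  irreducibility.\<close>

lemma (in bipartite_drg) thin_vector_exists:
  assumes irr: "irreducible_T_module adj x W" and ep: "endpoint adj x W = 2"
    and th: "thin adj x W" and diam: "4 \<le> D"
  shows "\<exists>v. thin_vector adj x v W"
proof -
  let ?E = "dual_idem adj x" and ?A = "adj_matrix adj"
  have W: "T_module adj x W" using irr by (simp add: irreducible_T_module_def)
  then have sub: "vec.subspace W" and AW: "\<And>w. w \<in> W \<Longrightarrow> ?A *v w \<in> W"
    using adj_matrix_in_algebra by (auto simp: T_module_def)
  have EW: "?E i *v w \<in> W" if "i \<le> D" "w \<in> W" for i w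
    using W that dual_idem_in_algebra[OF that(1)] unfolding T_module_def by blast
  have ne: "\<exists>i. (*v) (?E i) ` W \<noteq> {0}"
  proof -
    have "0 \<in> W" "W \<noteq> {0}" using irr vec.subspace_0[OF sub] by (auto simp: irreducible_T_module_def)
    then obtain w where w: "w \<in> W" "w \<noteq> 0" by blast
    then obtain z where "w $ z \<noteq> 0" by (auto simp: vec_eq_iff)
    then have "(?E (d x z) *v w) $ z \<noteq> 0" by (simp add: dual_idem_mult)
    then have "?E (d x z) *v w \<noteq> 0" by (metis zero_index)
    then show ?thesis using w(1) by blast
  qed
  have low: "(*v) (?E 1) ` W = {0}"
    using not_less_Least[of 1 "\<lambda>i. (*v) (?E i) ` W \<noteq> {0}"] ep by (simp add: endpoint_def)
  have "(*v) (?E 2) ` W \<noteq> {0}" using LeastI_ex[OF ne] ep by (simp add: endpoint_def)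
  moreover have "0 \<in> (*v) (?E 2) ` W"
    using vec.subspace_0[OF sub] by (metis image_eqI matrix_vector_mult_0_right)
  ultimately obtain w where w: "w \<in> W" "?E 2 *v w \<noteq> 0" by blast
  define v where "v = ?E 2 *v w"
  have v: "v \<in> W" "v \<noteq> 0" using w EW[of 2 w] diam by (auto simp: v_def)
  interpret endpoint_two_vector adj x v
  proof
    show "d x y \<noteq> 2 \<Longrightarrow> v $ y = 0" for y by (simp add: v_def dual_idem_mult)
  next
    fix w assume w: "adj x w"
    have "?E 1 *v (?A *v v) = 0" using AW[OF v(1)] low by blast
    then have "(?E 1 *v (?A *v v)) $ w = 0" by simp
    then show "(\<Sum>y\<in>{y. adj w y}. v $ y) = 0"
      using w by (simp add: dual_idem_mult adj_matrix_mult adj_iff_gdist)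
  qed (rule diam)
  have chain_mem: "chain n \<in> W" for n
  proof (cases "n + 2 \<le> D")
    case True
    then show ?thesis using EW dist_vec_mem[OF W v(1)] by (simp add: chain_def dist_part_eq)
  next
    case False
    then show ?thesis using chain_beyond vec.subspace_0[OF sub] by simp
  qed
  have down: "\<exists>e. E (n + 2) *v (A *v chain (n + 1)) = e *s chain n" for n
  proof (cases "chain n = 0")
    case True
    then show ?thesis using chain_Suc_zero[of n] by simp
  next
    case False
    then have n: "n + 2 \<le> D" using chain_beyond[of n] by linarith
    have "chain n \<in> (*v) (E (n + 2)) ` W"
      using chain_mem[of n] E_chain[of "n + 2" n] by (metis image_eqI)
    moreover have "E (n + 2) *v (A *v chain (n + 1)) \<in> (*v) (E (n + 2)) ` W"
      using AW chain_mem by blast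
    ultimately show ?thesis
      using vec_dim_le_1_multiple th n False by (meson thin_def)
  qed
  let ?U = "vec.span (range chain)"
  have mem: "a *s chain n \<in> ?U" for a n
    by (intro vec.span_scale vec.span_base) auto
  have "T_module adj x ?U"
  proof (rule T_moduleI)
    show "vec.subspace ?U" by (rule vec.subspace_span)
  next
    fix u assume "u \<in> ?U"
    then show "A *v u \<in> ?U"
    proof (rule span_linear_mem)
      fix u assume "u \<in> range chain"
      then obtain n where n: "u = chain n" by blast
      have "E (n + 1) *v (A *v chain n) \<in> ?U"
      proof (cases n)
        case 0
        then have "E (n + 1) *v (A *v chain n) = 0 *s chain 0"
          by (auto simp: vec_eq_iff E_mult adj_chain_0_down)
        then show ?thesis using mem by metis
      next
        case (Suc m)
        then show ?thesis using down[of m] mem by auto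
      qed
      then show "A *v u \<in> ?U"
        unfolding n by (subst adj_chain_split) (simp add: E_adj_chain mem vec.span_add)
    qed (simp_all add: vec.subspace_span matrix_vector_right_distrib vec.scale)
  next
    fix i u assume "u \<in> ?U"
    then show "E i *v u \<in> ?U"
    proof (rule span_linear_mem)
      fix u assume "u \<in> range chain"
      then show "E i *v u \<in> ?U" using mem[of 1] mem[of 0] by (auto simp: E_chain)
    qed (simp_all add: vec.subspace_span matrix_vector_right_distrib vec.scale)
  qed
  moreover have "?U \<subseteq> W" by (rule vec.span_minimal[OF _ sub]) (use chain_mem in auto)
  moreover have "?U \<noteq> {0}" using mem[of 1 0] v(2) chain_0 by auto
  ultimately have "W = ?U" using irr by (auto simp: irreducible_T_module_def)
  then have "thin_vector adj x v W"
    using v W down by unfold_locales auto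
  then show ?thesis ..
qed

context thin_vector
begin

lemma E_mem_multiple:
  assumes "w \<in> W"
  shows "\<exists>a. E (n + 2) *v w = a *s chain n"
proof -
  have "E (n + 2) *v w \<in> vec.span {chain n}"
    using assms unfolding W_eq
  proof (rule span_linear_mem)
    fix u assume "u \<in> range chain"
    then obtain m where "u = chain m" by blast
    then show "E (n + 2) *v u \<in> vec.span {chain n}"
      by (simp add: E_chain vec.span_base vec.span_zero)
  qed (simp_all add: vec.subspace_span matrix_vector_right_distrib vec.scale)
  then show ?thesis by (auto simp: vec.span_singleton)
qed

lemma part_multiple: "\<exists>a. part (n + 2) j = a *s chain n"
proof -
  have "v \<in> W" using W_eq chain_0 vec.span_base by (metis rangeI)
  then show ?thesis using E_mem_multiple dist_vec_mem[OF module] by (simp add: dist_part_eq)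
qed

lemma chain_norm_0: "0 < chain_norm 0"
  using v_nonzero chain_norm_nonneg[of 0] chain_norm_0_iff[of 0] chain_0 by (metis less_le)

lemma down_real:
  assumes "n + 3 \<le> D" "chain n \<noteq> 0"
  shows "\<exists>e :: real. E (n + 2) *v (A *v chain (n + 1)) = of_real e *s chain n
    \<and> (chain (n + 1) \<noteq> 0 \<longrightarrow> e \<noteq> 0)"
proof -
  obtain e where e: "E (n + 2) *v (A *v chain (n + 1)) = e *s chain n" using chain_down by blast
  have N: "chain_norm n \<noteq> 0" using assms chain_norm_0_iff by simp
  define r where "r = of_int (c (n + 1)) * chain_norm (n + 1) / chain_norm n"
  have "e = of_real r" using chain_norm_rec[OF e] N by (simp add: r_def field_simps)
  moreover have "r \<noteq> 0" if "chain (n + 1) \<noteq> 0"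
    using that N c_pos[of n] assms chain_norm_0_iff[of "n + 1"] by (simp add: r_def)
  ultimately show ?thesis using e by auto
qed

lemma multiple_inject: "a *s chain n = a' *s chain n \<Longrightarrow> chain n \<noteq> 0 \<Longrightarrow> a = a'"
  using vec.scale_right_imp_eq by blast

lemma far_part: 
  assumes "part (n + 2) (n + 2) = (s - 1) *s chain n"
  shows "part (n + 2) (n + 4) = (- s) *s chain n"
proof -
  have "chain n + (s - 1) *s chain n + part (n + 2) (n + 4) = 0"
    using part_sum[of n] assms by (simp add: chain_def)
  then show ?thesis by (simp add: vec_eq_iff algebra_simps eq_neg_iff_add_eq_0)
qed

text \<open>Thinness gives a complex multiple. For \<open>n = 0\<close> it is read off from
  \<open>E_adj_chain_1\<close>, whose coefficient is real as a quotient of norms;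
  \<open>E_far_down\<close> with \<open>far_part\<close> then carries reality from \<open>n\<close>
  to \<open>n + 1\<close>.\<close>

lemma middle_real: "n + 3 \<le> D \<Longrightarrow> \<exists>s :: real. part (n + 2) (n + 2) = of_real (s - 1) *s chain n"
proof (induction n)
  case 0
  obtain a where a: "part 2 2 = a *s chain 0" using part_multiple[of 0 2] by (auto simp: numeral_2_eq_2)
  have nz: "chain 0 \<noteq> 0" using chain_0 v_nonzero by simp
  obtain e :: real where "E 2 *v (A *v chain 1) = of_real e *s chain 0"
    using down_real[of 0] nz diam by (auto simp: numeral_2_eq_2)
  then have "of_real e *s chain 0 = (of_int (b 0) + of_int (c 2) * a) *s chain 0"
    using E_adj_chain_1 a by (simp add: vec.scale_left_distrib)
  then have "of_real e = of_int (b 0) + of_int (c 2) * a" using multiple_inject nz by blast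
  moreover have "c 2 \<noteq> 0" using c_pos[of 1] diam by (simp add: numeral_2_eq_2)
  ultimately have "a = of_real (((e - of_int (b 0)) / of_int (c 2) + 1) - 1)" by (simp add: field_simps)
  then show ?case using a by (metis add_0)
next
  case (Suc n)
  obtain a where a: "part (n + 3) (n + 3) = a *s chain (n + 1)"
    using part_multiple[of "n + 1" "n + 3"] by (auto simp: eval_nat_numeral)
  show ?case
  proof (cases "chain (n + 1) = 0")
    case True
    \<comment> \<open>Both vectors vanish, so any \<open>s\<close> fits; 0 is chosen.\<close>
    then have "part (Suc n + 2) (Suc n + 2) = of_real (0 - 1) *s chain (Suc n)"
      using a by (simp add: eval_nat_numeral)
    then show ?thesis by blast
  next
    case False
    then have nz: "chain n \<noteq> 0" using chain_Suc_zero by blast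
    obtain s where s: "part (n + 2) (n + 2) = of_real (s - 1) *s chain n" using Suc by auto
    obtain e :: real where e: "E (n + 2) *v (A *v chain (n + 1)) = of_real e *s chain n" "e \<noteq> 0"
      using down_real[of n] nz False Suc.prems by auto
    have "part (n + 3) (n + 5) = (- (a + 1)) *s chain (n + 1)"
      using far_part[of "n + 1" "a + 1"] a by (simp add: eval_nat_numeral)
    moreover have "part (n + 2) (n + 4) = (- of_real s) *s chain n"
      using far_part[of n "of_real s"] s by simp
    ultimately have "(- (a + 1) * of_real e) *s chain n = (of_int (b (n + 4)) * - of_real s) *s chain n"
      using E_far_down[of n] e(1) by (simp only: vec.scale vec.scale_scale)
    then have "- (a + 1) * of_real e = of_int (b (n + 4)) * - of_real s"
      using multiple_inject nz by blast
    then have "a = of_real (of_int (b (n + 4)) * s / e - 1)"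
      using e(2) by (simp add: field_simps add_eq_0_iff2 eq_neg_iff_add_eq_0)
    then have "part (Suc n + 2) (Suc n + 2) = of_real (of_int (b (n + 4)) * s / e - 1) *s chain (Suc n)"
      using a by (simp add: eval_nat_numeral)
    then show ?thesis by blast
  qed
qed

text \<open>This is \<open>s\<^sub>n\<^sub>+\<^sub>2\<close>. The shift by 1 makes the coefficients
  in \<open>part_sum\<close> equal to \<open>1\<close>, \<open>s - 1\<close>, \<open>- s\<close>, so
  the far part is \<open>- ratio n\<close> times \<open>chain n\<close>. Where
  \<open>chain n = 0\<close> the value is arbitrary.\<close>

definition ratio :: "nat \<Rightarrow> real" where
  "ratio n = (SOME s. part (n + 2) (n + 2) = of_real (s - 1) *s chain n)"

lemma middle_part: "n + 3 \<le> D \<Longrightarrow> part (n + 2) (n + 2) = of_real (ratio n - 1) *s chain n"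
  unfolding ratio_def by (rule someI_ex) (rule middle_real)

definition descent :: "nat \<Rightarrow> real" where
  "descent n = (if n = 0 then of_int (b 2) + of_int (c 2) * ratio 0
    else of_int (b (n + 2)) + of_int (c (n + 2)) * ratio n - of_int (c n) * ratio (n - 1))"

text \<open>\<open>E_adj_chain_1\<close> and \<open>E_adj_chain_down\<close> express the left side
  by middle parts; the constancy of \<open>b + c\<close> absorbs the shift in
  \<open>ratio - 1\<close>.\<close>

lemma chain_descent:
  assumes "n + 3 \<le> D"
  shows "E (n + 2) *v (A *v chain (n + 1)) = of_real (descent n) *s chain n"
proof (cases n)
  case 0
  have "b 2 + c 2 = b 0" using b_add_c diam by simp
  then have d: "of_real (descent 0) = of_int (b 0) + of_int (c 2) * (of_real (ratio 0 - 1) :: complex)"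
    by (simp add: descent_def algebra_simps flip: of_int_add)
  have p: "part 2 2 = of_real (ratio 0 - 1) *s chain 0"
    using middle_part[of 0] assms 0 by (simp add: numeral_2_eq_2)
  have "E 2 *v (A *v chain 1) = of_real (descent 0) *s chain 0"
    unfolding E_adj_chain_1 p d by (simp only: vec.scale_left_distrib vec.scale_scale)
  then show ?thesis using 0 by (simp add: numeral_2_eq_2)
next
  case (Suc m)
  have "b (m + 3) + c (m + 3) = b (m + 1) + c (m + 1)" using b_add_c assms Suc by simp
  then have "of_int (b (m + 1)) = (of_int (b (m + 3) + c (m + 3) - c (m + 1)) :: complex)" by simp
  then have d: "of_real (descent n) = of_int (b (m + 1)) + of_int (c (m + 3)) * of_real (ratio (m + 1) - 1)
      - of_int (c (m + 1)) * (of_real (ratio m - 1) :: complex)"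
    using Suc by (simp add: descent_def algebra_simps eval_nat_numeral)
  have m1: "part (m + 3) (m + 3) = of_real (ratio (m + 1) - 1) *s chain (m + 1)"
    using middle_part[of "m + 1"] assms Suc by (simp add: eval_nat_numeral)
  have m: "part (m + 2) (m + 2) = of_real (ratio m - 1) *s chain m"
    using middle_part[of m] assms Suc by simp
  have "E (m + 3) *v (A *v part (m + 2) (m + 2))
      = (of_int (c (m + 1)) * of_real (ratio m - 1)) *s chain (m + 1)"
    by (simp only: m vec.scale E_adj_chain vec.scale_scale mult.commute)
  then have "E (m + 3) *v (A *v chain (m + 2)) = of_int (b (m + 1)) *s chain (m + 1)
      + of_int (c (m + 3)) *s (of_real (ratio (m + 1) - 1) *s chain (m + 1))
      - (of_int (c (m + 1)) * of_real (ratio m - 1)) *s chain (m + 1)"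
    using E_adj_chain_down[of m] m1 by (simp add: eq_diff_eq)
  also have "\<dots> = of_real (descent n) *s chain (m + 1)"
    unfolding d by (simp only: vec.scale_left_distrib vec.scale_left_diff_distrib vec.scale_scale)
  finally show ?thesis using Suc by (simp add: eval_nat_numeral)
qed

lemma adj_chain_0: "A *v chain 0 = of_int (c 1) *s chain 1"
proof -
  have "E 1 *v (A *v chain 0) = 0" by (auto simp: vec_eq_iff E_mult adj_chain_0_down)
  then show ?thesis using adj_chain_split[of 0] E_adj_chain[of 0] by simp
qed

lemma adj_chain_Suc:
  "n + 3 \<le> D \<Longrightarrow> A *v chain (n + 1) = of_int (c (n + 2)) *s chain (n + 2) + of_real (descent n) *s chain n"
  using adj_chain_split[of "n + 1"] E_adj_chain[of "n + 1"] chain_descent[of n]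
  by (simp add: eval_nat_numeral)

lemma norm_recurrence:
  "norm_recurrence (\<lambda>j. of_int (b j)) (\<lambda>j. of_int (c j)) D ratio chain_norm descent"
proof
  show "0 < real_of_int (b j)" if "j < D" for j using b_pos that by simp
  show "real_of_int (c 0) = 0" by simp
  show "real_of_int (c 1) = 1" using c_1 diam by simp
  show "0 < real_of_int (c (Suc j))" if "j < D" for j using c_pos that by simp
  show "descent n = (if n = 0 then real_of_int (b 2) + real_of_int (c 2) * ratio 0
       else real_of_int (b (n + 2)) + real_of_int (c (n + 2)) * ratio n - real_of_int (c n) * ratio (n - 1))"
    for n by (rule descent_def)
  show "0 < chain_norm 0" by (rule chain_norm_0)
  show "0 \<le> chain_norm n" for n by (rule chain_norm_nonneg)
  show "chain_norm n = 0 \<Longrightarrow> chain_norm (n + 1) = 0" for n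
    using chain_norm_0_iff chain_Suc_zero by blast
next
  fix n assume "n + 3 \<le> D"
  then have "of_real (descent n * chain_norm n) = (of_real (of_int (c (n + 1)) * chain_norm (n + 1)) :: complex)"
    using chain_norm_rec[OF chain_descent] by simp
  then show "descent n * chain_norm n = real_of_int (c (n + 1)) * chain_norm (n + 1)"
    by (simp only: of_real_eq_iff)
next
  fix n assume n: "n + 4 \<le> D" "chain_norm n \<noteq> 0"
  \<comment> \<open>The recurrence for \<open>ratio\<close> compares coefficients of
    \<open>chain n\<close> in \<open>E_far_down\<close>.\<close>
  have "part (n + 3) (n + 5) = (- of_real (ratio (n + 1))) *s chain (n + 1)"
    using far_part[of "n + 1" "of_real (ratio (n + 1))"] middle_part[of "n + 1"] n by (simp add: eval_nat_numeral)
  moreover have "part (n + 2) (n + 4) = (- of_real (ratio n)) *s chain n"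
    using far_part[of n "of_real (ratio n)"] middle_part[of n] n by simp
  ultimately have "(- of_real (ratio (n + 1)) * of_real (descent n)) *s chain n
      = (of_int (b (n + 4)) * - of_real (ratio n)) *s chain n"
    using E_far_down[of n] chain_descent[of n] n by (simp only: vec.scale vec.scale_scale)
  then have "- of_real (ratio (n + 1)) * of_real (descent n) = of_int (b (n + 4)) * - (of_real (ratio n) :: complex)"
    using multiple_inject n chain_norm_0_iff by blast
  then have "of_real (ratio (n + 1) * descent n) = (of_real (of_int (b (n + 4)) * ratio n) :: complex)" by simp
  then show "ratio (n + 1) * descent n = real_of_int (b (n + 4)) * ratio n" by (simp only: of_real_eq_iff)
qed

definition carry :: "(nat \<Rightarrow> complex^'a) \<Rightarrow> complex^'a \<Rightarrow> complex^'a" where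
  "carry g w = (\<Sum>n\<in>{n. n \<le> D \<and> chain n \<noteq> 0}.
     (w $ (SOME z. chain n $ z \<noteq> 0) / chain n $ (SOME z. chain n $ z \<noteq> 0)) *s g n)"

text \<open>\<open>carry g\<close> is the linear map sending \<open>chain n\<close> to \<open>g n\<close>: the chain vectors have disjoint supports, so
  a coordinate is read off at any point of the support.\<close>

lemma carry_add: "carry g (u + w) = carry g u + carry g w"
  by (simp add: carry_def add_divide_distrib vec.scale_left_distrib sum.distrib)

lemma carry_scale: "carry g (a *s w) = a *s carry g w"
  by (simp add: carry_def vec.scale_sum_right)

lemma carry_chain:
  assumes "chain n = 0 \<Longrightarrow> g n = 0"
  shows "carry g (chain n) = g n"
proof -
  let ?z = "\<lambda>m. SOME z. chain m $ z \<noteq> 0"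
  have z: "chain m $ ?z m \<noteq> 0" if "chain m \<noteq> 0" for m
    by (rule someI_ex[of "\<lambda>z. chain m $ z \<noteq> 0"]) (use that in \<open>auto simp: vec_eq_iff\<close>)
  have "(chain n $ ?z m / chain m $ ?z m) *s g m = (if m = n then g n else 0)" if "chain m \<noteq> 0" for m
  proof -
    have "d x (?z m) = m + 2" using z[OF that] chain_outside by blast
    then have "m \<noteq> n \<Longrightarrow> chain n $ ?z m = 0" by (intro chain_outside) auto
    then show ?thesis using z[OF that] by auto
  qed
  then have "carry g (chain n) = (\<Sum>m\<in>{m. m \<le> D \<and> chain m \<noteq> 0}. if m = n then g n else 0)"
    unfolding carry_def by (intro sum.cong) auto
  also have "\<dots> = g n"
    using assms chain_beyond[of n] by (subst sum.delta) auto
  finally show ?thesis .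
qed

end

section \<open>Isomorphism of modules with equal first ratio\<close>

lemma span_chain_zero:
  fixes f :: "complex^'n::finite \<Rightarrow> complex^'n"
  assumes "w \<in> vec.span (range ch)" and "\<And>u w. f (u + w) = f u + f w" and "\<And>a w. f (a *s w) = a *s f w"
    and "\<And>n. f (ch n) = 0"
  shows "f w = 0"
proof -
  have "f w \<in> {0}"
    by (rule span_linear_mem[OF assms(1)]) (use assms in \<open>auto simp: vec.subspace_def\<close>)
  then show ?thesis by simp
qed

text \<open>The map matching the two chains is the isomorphism: equal \<open>ratio 0\<close> forces
  the same vanishing indices and the same \<open>descent\<close> along the nonzero vectors, which
  determine the action of \<open>A\<close> on the chain.\<close>

lemma isomorphic_of_ratio_eq:
  assumes "thin_vector adj x v W" and "thin_vector adj x v' W'"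
    and "thin_vector.ratio adj x v 0 = thin_vector.ratio adj x v' 0"
  shows "T_isomorphic adj x W W'"
proof -
  interpret p: thin_vector adj x v W by fact
  interpret q: thin_vector adj x v' W' by fact
  note unique = norm_recurrence_unique[OF p.norm_recurrence q.norm_recurrence assms(3)]
  have zero: "p.chain n = 0 \<longleftrightarrow> q.chain n = 0" for n
    using unique[of n] p.chain_norm_0_iff q.chain_norm_0_iff p.chain_beyond q.chain_beyond
    by (metis not_less)
  let ?\<sigma> = "p.carry q.chain" and ?\<tau> = "q.carry p.chain"
  have \<sigma>: "?\<sigma> (p.chain n) = q.chain n" and \<tau>: "?\<tau> (q.chain n) = p.chain n" for n
    using p.carry_chain q.carry_chain zero by auto
  have \<sigma>0: "?\<sigma> 0 = 0" using p.carry_scale[of q.chain 0 0] by simp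
  note linear = p.carry_add p.carry_scale q.carry_add q.carry_scale matrix_vector_right_distrib vec.scale
    vec.scale_right_distrib vec.scale_right_diff_distrib
  show ?thesis
  proof (rule T_isomorphicI[where \<sigma> = ?\<sigma> and \<tau> = ?\<tau>])
    show "T_module adj x W" by (rule p.module)
    show "?\<sigma> (u + w) = ?\<sigma> u + ?\<sigma> w" for u w by (rule p.carry_add)
    show "?\<sigma> (a *s w) = a *s ?\<sigma> w" for a w by (rule p.carry_scale)
  next
    fix w assume "w \<in> W"
    then have w: "w \<in> vec.span (range p.chain)" using p.W_eq by simp
    have "?\<tau> (?\<sigma> w) - w = 0"
      by (rule span_chain_zero[OF w]) (auto simp: linear \<sigma> \<tau>)
    moreover have "?\<sigma> w \<in> vec.span (range q.chain)"
      by (rule span_linear_mem[OF w vec.subspace_span]) (auto simp: linear \<sigma> vec.span_base)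
    ultimately show "?\<sigma> w \<in> W' \<and> ?\<tau> (?\<sigma> w) = w" using q.W_eq by simp
  next
    fix w assume "w \<in> W'"
    then have w: "w \<in> vec.span (range q.chain)" using q.W_eq by simp
    have "?\<sigma> (?\<tau> w) - w = 0"
      by (rule span_chain_zero[OF w]) (auto simp: linear \<sigma> \<tau>)
    moreover have "?\<tau> w \<in> vec.span (range p.chain)"
      by (rule span_linear_mem[OF w vec.subspace_span]) (auto simp: linear \<tau> vec.span_base)
    ultimately show "?\<tau> w \<in> W \<and> ?\<sigma> (?\<tau> w) = w" using p.W_eq by simp
  next
    fix w assume "w \<in> W"
    then have w: "w \<in> vec.span (range p.chain)" using p.W_eq by simp
    have "?\<sigma> (p.A *v w) - p.A *v ?\<sigma> w = 0"
    proof (rule span_chain_zero[OF w])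
      fix n
      show "?\<sigma> (p.A *v p.chain n) - p.A *v ?\<sigma> (p.chain n) = 0"
      proof (cases n)
        case 0
        then show ?thesis by (simp add: \<sigma> p.adj_chain_0 q.adj_chain_0 p.carry_scale)
      next
        case (Suc m)
        show ?thesis
        proof (cases "m + 3 \<le> p.D \<and> p.chain m \<noteq> 0")
          case True
          then have "p.descent m = q.descent m"
            using unique[of m] p.chain_norm_0_iff by auto
          then show ?thesis
            using p.adj_chain_Suc[of m] q.adj_chain_Suc[of m] True Suc
            by (simp add: \<sigma> p.carry_scale p.carry_add)
        next
          case False
          then have "p.chain n = 0" using p.chain_beyond[of n] p.chain_Suc_zero[of m] Suc by auto
          then show ?thesis using \<sigma>0 by simp
        qed
      qed
    qed (auto simp: linear)
    then show "?\<sigma> (adj_matrix adj *v w) = adj_matrix adj *v ?\<sigma> w" by simp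
  next
    fix i w assume "w \<in> W"
    then have w: "w \<in> vec.span (range p.chain)" using p.W_eq by simp
    have "?\<sigma> (p.E i *v w) - p.E i *v ?\<sigma> w = 0"
      by (rule span_chain_zero[OF w]) (auto simp: linear p.E_chain q.E_chain \<sigma> \<sigma>0)
    then show "?\<sigma> (dual_idem adj x i *v w) = dual_idem adj x i *v ?\<sigma> w" by simp
  qed
qed

section \<open>Positivity of \<open>\<Delta>\<^sub>i\<close> and the linear relation\<close>

context bipartite_drg
begin

lemma c_ge_1: "j < D \<Longrightarrow> 1 \<le> c (Suc j)" and b_ge_1: "j < D \<Longrightarrow> 1 \<le> b j"
  using c_pos[of j] b_pos[of j] by auto

text \<open>A variance is nonnegative; if there is no \<open>y\<close> to average over,
  \<open>Delta\<close> is a product of two nonnegative factors.\<close>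

lemma Delta_nonneg:
  assumes D: "l + 3 \<le> D"
  shows "0 \<le> Delta adj (l + 2)"
proof -
  obtain x z where xz: "d x z = l + 2" using gdist_attained[of "l + 2"] D by auto
  let ?p = "int (card {y. d x y = 2 \<and> d z y = l + 2})"
  have pos: "0 < c (l + 2)" "0 < b (l + 2)" using c_pos[of "l + 1"] b_pos D by auto
  show ?thesis
  proof (cases "?p = 0")
    case True
    have "0 \<le> (b (l + 1) - 1) * (c (l + 3) - 1)"
      using b_ge_1[of "l + 1"] c_ge_1[of "l + 2"] D by (simp add: eval_nat_numeral)
    moreover have "inter_num adj (l + 2) 2 (l + 2) = 0"
      using True card_same_level_eq[OF xz] D by linarith
    ultimately show ?thesis by (simp add: Delta_def eval_nat_numeral)
  next
    case False
    have "0 \<le> ?p * (c (l + 2) * (b (l + 2) * Delta adj (l + 2)))"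
      unfolding common_variance[OF xz D, symmetric] by (intro sum_nonneg) auto
    then have "0 \<le> (?p * (c (l + 2) * b (l + 2))) * Delta adj (l + 2)" by (simp only: mult.assoc)
    moreover have "0 < ?p" using False by linarith
    then have "0 < ?p * (c (l + 2) * b (l + 2))" using pos by (intro mult_pos_pos)
    ultimately show ?thesis by (simp only: zero_le_mult_iff) linarith
  qed
qed

text \<open>The variance is zero, so the count equals its mean; that depends on intersection numbers
  only, hence one \<open>\<gamma>\<close> serves all triples.\<close>

lemma common_constant:
  assumes D: "l + 3 \<le> D" and Delta: "Delta adj (l + 2) = 0"
  shows "\<exists>\<gamma> :: real. \<forall>x y z. d x z = l + 2 \<and> d x y = 2 \<and> d z y = l + 2
    \<longrightarrow> real (common_near x z (l + 1) y) = \<gamma>"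
proof -
  let ?p = "inter_num adj (l + 2) 2 (l + 2)"
  let ?K = "c (l + 2) * (b (l + 1) - 1)"
  have "real (common_near x z (l + 1) y) = of_int ?K / real ?p"
    if xz: "d x z = l + 2" and y: "d x y = 2" "d z y = l + 2" for x y z
  proof -
    let ?Y = "{y. d x y = 2 \<and> d z y = l + 2}"
    have p: "card ?Y = ?p" using card_same_level_eq[OF xz] D by simp
    have "?Y \<noteq> {}" using y by auto
    then have "?p \<noteq> 0" using p by (metis card_eq_0_iff finite)
    moreover have "\<forall>y\<in>?Y. (int ?p * int (common_near x z (l + 1) y) - ?K)\<^sup>2 = 0"
      using common_variance[OF xz D] Delta unfolding p
      by (subst sum_nonneg_eq_0_iff[symmetric]) auto
    then have "int ?p * int (common_near x z (l + 1) y) = ?K" using y by simp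
    then have "real ?p * real (common_near x z (l + 1) y) = of_int ?K"
      by (metis of_int_mult of_int_of_nat_eq)
    ultimately show ?thesis by (simp add: field_simps)
  qed
  then show ?thesis by blast
qed

text \<open>The hypothesis is summed over the \<open>y\<close> adjacent to a fixed neighbour
  \<open>w\<close> of \<open>x\<close>: a \<open>w\<close> on level \<open>l + 1\<close> gives the
  first equation, one on level \<open>l + 3\<close> the second. Both exist since
  \<open>c (l + 2)\<close> and \<open>b (l + 2)\<close> are positive.\<close>

lemma linear_relation:
  fixes \<alpha> \<beta> :: complex
  assumes D: "l + 3 \<le> D"
    and eq: "\<And>x y z. d x y = 2 \<Longrightarrow> d x z = l + 2 \<Longrightarrow> d y z = l + 2 \<Longrightarrow>
      \<alpha> + \<beta> * of_nat (common_near x z (l + 1) y)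
        = of_nat (card {u. adj z u \<and> d x u = l + 1 \<and> d y u = l + 1})"
  shows "\<alpha> * of_int (b (l + 1) - 1)
      + \<beta> * of_int ((b (l + 1) - 1) + (c (l + 2) - 1 - c (l + 1)) * (c 2 - 1))
      = of_int (c (l + 1) * (b (l + 1) - 1) + (c (l + 2) - c (l + 1)) * (c (l + 2) - c (l + 1) - 1))"
    and "\<alpha> * of_int (c (l + 3) - 1) + \<beta> * of_int (c (l + 2) * (c 2 - 1))
      = of_int (c (l + 2) * (c (l + 2) - 1))"
proof -
  obtain x z where xz: "d x z = l + 2" using gdist_attained[of "l + 2"] D by auto
  have pos: "0 < c (l + 2)" "0 < b (l + 2)" using c_pos[of "l + 1"] b_pos D by auto
  let ?Y = "\<lambda>w. {y. adj w y \<and> d z y = l + 2 \<and> y \<noteq> x}"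
  have sum: "\<alpha> * of_int (int (card (?Y w))) + \<beta> * of_int (\<Sum>y\<in>?Y w. int (common_near x z (l + 1) y))
      = of_int (\<Sum>y\<in>?Y w. int (card {u. adj z u \<and> d x u = l + 1 \<and> d y u = l + 1}))"
    if w: "adj x w" for w
  proof -
    have "(\<Sum>y\<in>?Y w. \<alpha> + \<beta> * of_nat (common_near x z (l + 1) y))
        = (\<Sum>y\<in>?Y w. of_nat (card {u. adj z u \<and> d x u = l + 1 \<and> d y u = l + 1}))"
      using gdist_2I[OF w] xz gdist_sym[of z] by (intro sum.cong refl eq) auto
    then show ?thesis by (simp add: sum.distrib sum_distrib_left mult.commute)
  qed
  have "{w. adj x w \<and> d z w = l + 1} \<noteq> {}"
    using card_lower[OF xz] pos by (metis card.empty less_irrefl of_nat_0)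
  then obtain w where w: "adj x w" "d z w = l + 1" by blast
  show "\<alpha> * of_int (b (l + 1) - 1)
      + \<beta> * of_int ((b (l + 1) - 1) + (c (l + 2) - 1 - c (l + 1)) * (c 2 - 1))
      = of_int (c (l + 1) * (b (l + 1) - 1) + (c (l + 2) - c (l + 1)) * (c (l + 2) - c (l + 1) - 1))"
    using sum[OF w(1)]
    unfolding sum_common_near_inner[OF xz w] sum_common_dual_inner[OF xz w] card_neighbours_lower[OF xz w] .
  have "{w. adj x w \<and> d z w = l + 3} \<noteq> {}"
    using card_upper[OF xz] pos by (metis card.empty less_irrefl of_nat_0)
  then obtain w where w: "adj x w" "d z w = l + 3" by blast
  show "\<alpha> * of_int (c (l + 3) - 1) + \<beta> * of_int (c (l + 2) * (c 2 - 1))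
      = of_int (c (l + 2) * (c (l + 2) - 1))"
    using sum[OF w(1)]
    unfolding sum_common_near_outer[OF xz w] sum_common_dual_outer[OF xz w] card_neighbours_upper[OF xz w] .
qed

lemma Delta_card:
  assumes D: "l + 3 \<le> D"
  shows "c 2 * Delta adj (l + 2) = c 2 * (b (l + 1) - 1) * (c (l + 3) - 1)
    - (c 2 - 1) * (c (l + 2) * (b (l + 1) - 1) + b (l + 2) * (c (l + 3) - 1))"
proof -
  obtain x z where xz: "d x z = l + 2" using gdist_attained[of "l + 2"] D by auto
  have p: "c 2 * int (inter_num adj (l + 2) 2 (l + 2))
      = c (l + 2) * (b (l + 1) - 1) + b (l + 2) * (c (l + 3) - 1)"
    using card_same_level[OF xz] card_same_level_eq[OF xz] D by simp
  have "c 2 * Delta adj (l + 2) = c 2 * (b (l + 1) - 1) * (c (l + 3) - 1)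
    - (c 2 - 1) * (c 2 * int (inter_num adj (l + 2) 2 (l + 2)))"
    by (simp add: Delta_def eval_nat_numeral algebra_simps)
  then show ?thesis unfolding p .
qed

text \<open>Cramer's rule for \<open>linear_relation\<close>: by \<open>Delta_card\<close> and the
  constancy of \<open>b + c\<close>, the determinant is \<open>c 2 * Delta adj (l + 2)\<close> up to
  sign.\<close>

lemma linear_relation_solution:
  fixes \<alpha> \<beta> :: complex
  assumes D: "l + 3 \<le> D" and Delta: "Delta adj (l + 2) \<noteq> 0"
    and eq: "\<And>x y z. d x y = 2 \<Longrightarrow> d x z = l + 2 \<Longrightarrow> d y z = l + 2 \<Longrightarrow>
      \<alpha> + \<beta> * of_nat (common_near x z (l + 1) y)
        = of_nat (card {u. adj z u \<and> d x u = l + 1 \<and> d y u = l + 1})"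
  shows "\<alpha> = of_int (c (l + 2) * (c (l + 2) - 1) * (b (l + 1) - c 2)
        - c (l + 2) * c (l + 1) * (b (l + 2) - 1) * (c 2 - 1)) / of_int (c 2 * Delta adj (l + 2))"
    and "\<beta> = of_int (c (l + 2) * (c (l + 3) - c (l + 2)) * (b (l + 1) - 1)
        - b (l + 2) * (c (l + 3) - 1) * (c (l + 2) - c (l + 1))) / of_int (c 2 * Delta adj (l + 2))"
proof -
  note rel = linear_relation[OF D eq, simplified of_int_mult of_int_add of_int_diff of_int_1]
  have "b (l + 1) + c (l + 1) = b (l + 2) + c (l + 2)" using b_add_c D by simp
  then have k: "(of_int (b (l + 2)) :: complex) = of_int (b (l + 1)) + of_int (c (l + 1)) - of_int (c (l + 2))"
    by (simp flip: of_int_add of_int_diff)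
  have "0 < c 2" using c_pos[of 1] D by (simp add: numeral_2_eq_2)
  then have nz: "of_int (c 2 * Delta adj (l + 2)) \<noteq> (0 :: complex)" using Delta by simp
  show "\<alpha> = of_int (c (l + 2) * (c (l + 2) - 1) * (b (l + 1) - c 2)
        - c (l + 2) * c (l + 1) * (b (l + 2) - 1) * (c 2 - 1)) / of_int (c 2 * Delta adj (l + 2))"
  proof (subst nonzero_eq_divide_eq[OF nz])
    show "\<alpha> * of_int (c 2 * Delta adj (l + 2)) = of_int (c (l + 2) * (c (l + 2) - 1) * (b (l + 1) - c 2)
        - c (l + 2) * c (l + 1) * (b (l + 2) - 1) * (c 2 - 1))"
      unfolding Delta_card[OF D] of_int_mult of_int_add of_int_diff of_int_1 k
      using rel by algebra
  qed
  show "\<beta> = of_int (c (l + 2) * (c (l + 3) - c (l + 2)) * (b (l + 1) - 1)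
        - b (l + 2) * (c (l + 3) - 1) * (c (l + 2) - c (l + 1))) / of_int (c 2 * Delta adj (l + 2))"
  proof (subst nonzero_eq_divide_eq[OF nz])
    show "\<beta> * of_int (c 2 * Delta adj (l + 2)) = of_int (c (l + 2) * (c (l + 3) - c (l + 2)) * (b (l + 1) - 1)
        - b (l + 2) * (c (l + 3) - 1) * (c (l + 2) - c (l + 1)))"
      unfolding Delta_card[OF D] of_int_mult of_int_add of_int_diff of_int_1 k
      using rel by algebra
  qed
qed

end

text \<open>The balance conditions are added over the neighbours \<open>w\<close> of
  \<open>x\<close> at distance \<open>n + 1\<close> from \<open>z\<close>. Each \<open>y\<close>
  gets weight \<open>common_near\<close>, which is \<open>c 2\<close> at distance \<open>n\<close>
  from \<open>z\<close>, \<open>\<gamma>\<close> at distance \<open>n + 2\<close>, and 0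
  otherwise.\<close>

lemma (in endpoint_two_vector) chain_common_relation:
  assumes const: "\<And>y z. d x z = n + 2 \<Longrightarrow> d x y = 2 \<Longrightarrow> d z y = n + 2 \<Longrightarrow>
      real (common_near x z (n + 1) y) = \<gamma>"
  shows "of_int (c 2) *s chain n + of_real \<gamma> *s part (n + 2) (n + 2) = 0"
proof (rule vec_eq_iff[THEN iffD2], rule allI)
  fix z
  show "(of_int (c 2) *s chain n + of_real \<gamma> *s part (n + 2) (n + 2)) $ z = 0 $ z"
  proof (cases "d x z = n + 2")
    case True
    let ?L = "{w. adj x w \<and> d z w = n + 1}"
    have "0 = (\<Sum>w\<in>?L. \<Sum>y\<in>{y. adj w y}. v $ y)" using balanced by simp
    also have "\<dots> = (\<Sum>w\<in>?L. \<Sum>y\<in>UNIV. if adj w y then v $ y else 0)"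
      by (simp add: sum.If_cases)
    also have "\<dots> = (\<Sum>y\<in>UNIV. \<Sum>w\<in>?L. if adj w y then v $ y else 0)"
      by (rule sum.swap)
    also have "\<dots> = (\<Sum>y\<in>UNIV. of_nat (common_near x z (n + 1) y) * v $ y)"
      by (simp add: sum.If_cases Int_def adj_sym common_near_def conj_commute conj_left_commute)
    also have "\<dots> = (\<Sum>y\<in>UNIV. (of_int (c 2) * (if d x z = n + 2 \<and> d y z = n then 1 else 0)
        + of_real \<gamma> * (if d x z = n + 2 \<and> d y z = n + 2 then 1 else 0)) * v $ y)"
    proof (rule sum_weighted_cong)
      fix y assume y: "d x y = 2"
      consider "d y z = n" | "d y z = n + 2" | "d y z \<noteq> n" "d y z \<noteq> n + 2" by blast
      then show "of_nat (common_near x z (n + 1) y)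
        = of_int (c 2) * (if d x z = n + 2 \<and> d y z = n then 1 else 0)
        + of_real \<gamma> * (if d x z = n + 2 \<and> d y z = n + 2 then 1 else (0::complex))"
      proof cases
        case 1
        then have "d z y = n" using gdist_sym by metis
        then have "{w. adj x w \<and> adj y w \<and> d z w = n + 1} = {w. adj x w \<and> adj y w}"
          using near_between[OF True] adj_sym by blast
        then have "int (common_near x z (n + 1) y) = c 2"
          using card_common[OF y] by (simp add: common_near_def)
        then have "of_nat (common_near x z (n + 1) y) = (of_int (c 2) :: complex)"
          by (metis of_int_of_nat_eq)
        then show ?thesis using True 1 by simp
      next
        case 2
        then have "real (common_near x z (n + 1) y) = \<gamma>" using const True y gdist_sym by metis
        then have "of_nat (common_near x z (n + 1) y) = (of_real \<gamma> :: complex)"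
          by (metis of_real_of_nat_eq)
        then show ?thesis using True 2 by simp
      next
        case 3
        have "\<not> (adj x w \<and> adj y w \<and> d z w = n + 1)" for w
          using adj_gdist[of y w z] 3 gdist_sym[of y z] by linarith
        then have "common_near x z (n + 1) y = 0" by (simp add: common_near_def)
        then show ?thesis using 3 by simp
      qed
    qed
    finally show ?thesis
      by (simp add: chain_def part_nth distrib_right sum.distrib sum_distrib_left mult.assoc)
  qed (simp add: chain_outside part_outside)
qed

lemma (in thin_vector) ratio_relation:
  assumes "n + 4 \<le> D"
    and "\<And>y z. d x z = n + 2 \<Longrightarrow> d x y = 2 \<Longrightarrow> d z y = n + 2 \<Longrightarrow>
      real (common_near x z (n + 1) y) = \<gamma>"
  shows "of_int (c 2) + \<gamma> * (ratio n - 1) = 0"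
proof -
  interpret r: norm_recurrence "\<lambda>j. of_int (b j)" "\<lambda>j. of_int (c j)" D ratio chain_norm descent
    by (rule norm_recurrence)
  have "chain n \<noteq> 0" using r.N_pos[OF assms(1)] chain_norm_0_iff[of n] by simp
  have "of_int (c 2) *s chain n + of_real \<gamma> *s (of_real (ratio n - 1) *s chain n) = 0"
    using chain_common_relation[OF assms(2)] middle_part[of n] assms(1) by simp
  then have "(of_int (c 2) + of_real \<gamma> * of_real (ratio n - 1)) *s chain n = 0"
    by (simp only: vec.scale_left_distrib vec.scale_scale)
  then have "of_int (c 2) + of_real \<gamma> * of_real (ratio n - 1) = (0 :: complex)"
    using \<open>chain n \<noteq> 0\<close> vec.scale_eq_0_iff by blast
  then have "of_real (of_int (c 2) + \<gamma> * (ratio n - 1)) = (0 :: complex)" by simp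
  then show ?thesis by (simp only: of_real_eq_0_iff)
qed

lemma (in bipartite_drg) Delta_nonzero:
  assumes D: "n + 4 \<le> D" and W: "irreducible_T_module adj x W" "endpoint adj x W = 2" "thin adj x W"
    and W': "irreducible_T_module adj x W'" "endpoint adj x W' = 2" "thin adj x W'"
    and "\<not> T_isomorphic adj x W W'"
  shows "Delta adj (n + 2) \<noteq> 0"
proof
  assume Delta: "Delta adj (n + 2) = 0"
  obtain v v' where v: "thin_vector adj x v W" and v': "thin_vector adj x v' W'"
    using thin_vector_exists W W' D by (metis add_leD2)
  interpret p: thin_vector adj x v W by fact
  interpret q: thin_vector adj x v' W' by fact
  \<comment> \<open>\<open>\<gamma>\<close> comes from the graph alone, so both modules satisfy the
    same linear equation for their \<open>ratio n\<close>; \<open>c 2 > 0\<close> excludes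
    \<open>\<gamma> = 0\<close>, so its solution is unique.\<close>
  obtain \<gamma> :: real where \<gamma>: "\<And>x y z. d x z = n + 2 \<Longrightarrow> d x y = 2 \<Longrightarrow> d z y = n + 2 \<Longrightarrow>
      real (common_near x z (n + 1) y) = \<gamma>"
    using common_constant[of n] Delta D by auto
  have rel: "of_int (c 2) + \<gamma> * (p.ratio n - 1) = 0" "of_int (c 2) + \<gamma> * (q.ratio n - 1) = 0"
    using p.ratio_relation[OF D \<gamma>] q.ratio_relation[OF D \<gamma>] by auto
  have "0 < c 2" using c_pos[of 1] D by (simp add: numeral_2_eq_2)
  then have "\<gamma> \<noteq> 0" using rel(1) by auto
  moreover have "\<gamma> * (p.ratio n - 1) = \<gamma> * (q.ratio n - 1)" using rel by linarith
  ultimately have "p.ratio n = q.ratio n" by simp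
  then have "p.ratio 0 = q.ratio 0"
    using norm_recurrence_inj[OF p.norm_recurrence q.norm_recurrence D] by blast
  then show False using isomorphic_of_ratio_eq[OF v v'] assms by blast
qed

theorem theorem10p6:
  fixes adj :: "'a::finite \<Rightarrow> 'a \<Rightarrow> bool" and D i :: nat and k :: int
    and c b :: "nat \<Rightarrow> int"
  defines "c \<equiv> inter_c adj" and "b \<equiv> inter_b adj"
  assumes "distance_regular adj" and "bipartite_graph adj"
    and "k = b 0" and "k \<ge> 3"
    and "D = diam adj" and "D \<ge> 4"
    and "\<And>x. exactly_two_irreducible_endpoint_two adj x"
    and "\<And>x W. irreducible_T_module adj x W \<Longrightarrow> endpoint adj x W = 2 \<Longrightarrow> thin adj x W"
    and "2 \<le> i" and "i \<le> D - 2"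
  shows "Delta adj i > 0 \<and>
    (\<forall>\<alpha> \<beta> :: complex.
      (\<forall>x y z. gdist adj x y = 2 \<and> gdist adj x z = i \<and> gdist adj y z = i \<longrightarrow>
         \<alpha> + \<beta> * of_nat (card (sphere_at adj 1 x \<inter> sphere_at adj 1 y \<inter> sphere_at adj (i - 1) z))
         = of_nat (card (sphere_at adj (i - 1) x \<inter> sphere_at adj (i - 1) y \<inter> sphere_at adj 1 z)))
      \<longrightarrow>
      \<alpha> = of_int (c i * (c i - 1) * (b (i - 1) - c 2) - c i * c (i - 1) * (b i - 1) * (c 2 - 1))
            / of_int (c 2 * Delta adj i) \<and>
      \<beta> = of_int (c i * (c (i + 1) - c i) * (b (i - 1) - 1) - b i * (c (i + 1) - 1) * (c i - c (i - 1)))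
            / of_int (c 2 * Delta adj i))"
proof -
  interpret g: bipartite_drg adj using assms(3,4) by unfold_locales
  obtain l where i: "i = l + 2" using \<open>2 \<le> i\<close> by (metis add.commute le_Suc_ex)
  \<comment> \<open>This is the range in which \<open>chain l\<close> is nonzero and
    \<open>ratio l\<close> determines \<open>ratio 0\<close>.\<close>
  have l: "l + 4 \<le> diam adj" using i assms(7,8,12) by simp
  \<comment> \<open>Any base vertex will do, as \<open>Delta\<close> does not refer to one.\<close>
  fix x :: 'a
  obtain W W' where "irreducible_T_module adj x W" "endpoint adj x W = 2"
      "irreducible_T_module adj x W'" "endpoint adj x W' = 2" "\<not> T_isomorphic adj x W W'"
    using assms(9)[of x] by (auto simp: exactly_two_irreducible_endpoint_two_def)
  then have "Delta adj (l + 2) \<noteq> 0" using g.Delta_nonzero[OF l] assms(10) by blast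
  then have Delta: "0 < Delta adj (l + 2)" using g.Delta_nonneg[of l] l by simp
  have near: "sphere_at adj 1 x \<inter> sphere_at adj 1 y \<inter> sphere_at adj (l + 1) z
      = {w. adj x w \<and> adj y w \<and> gdist adj z w = l + 1}" for x y z
    by (auto simp: sphere_at_def g.adj_iff_gdist)
  have dual: "sphere_at adj (l + 1) x \<inter> sphere_at adj (l + 1) y \<inter> sphere_at adj 1 z
      = {u. adj z u \<and> gdist adj x u = l + 1 \<and> gdist adj y u = l + 1}" for x y z
    by (auto simp: sphere_at_def g.adj_iff_gdist)
  have i': "i - 1 = l + 1" "i + 1 = l + 3" using i by auto
  have l3: "l + 3 \<le> diam adj" using l by simp
  note solution = g.linear_relation_solution[OF l3 less_imp_neq[OF Delta, symmetric], unfolded g.common_near_def]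
  show ?thesis
    unfolding i' unfolding i c_def b_def near dual
    by (intro conjI allI impI Delta; rule solution; blast)
qed

end
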